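(* Assume $\mathbb E[\xi+\xi^{-1}+\nu^2]<\infty$. Then, almost surely, $$\frac{C_n}{\mathbb E[C_n]}\longrightarrow W \qquad\text{as } n\to\infty,$$ where $W=\lim_{n\to\infty} m^{-n}\#\mathbb T_n$.
   Context: Let $\mathbf p=(p_k)_{k\ge0}$ be a probability distribution on the nonnegative integers with $p_0=0$ and finite mean $m=\sum_k kp_k>1$. Let $\mathbb T$ be a Galton–Watson tree with offspring distribution $\mathbf p$, rooted at $\varnothing$, and let $\nu$ denote the number of children of the root (so $\nu\sim\mathbf p$). For a vertex $x$, $|x|$ is its depth (graph distance to the root) and $\overleftarrow{x}$ its parent (if $x\ne\varnothing$). Let $\mathbb T_n=\{x\in\mathbb T:|x|=n\}$. The depth of the edge $e=\{\overleftarrow x,x\}$ is $d(e)=|x|$. Let $\xi$ be a strictly positive random variable; conditionally on $\mathbb T$, let $\{\xi(e)\}$ be i.i.d. copies of $\xi$ indexed by the edges of $\mathbb T$, and assign to each edge $e$ the resistance $r(e)=m^{d(e)}\xi(e)$ (conductance $1/r(e)$). $C_n$ denotes the effective conductance, in this electric network, between the root $\varnothing$ and the set $\mathbb T_n$. It is known that $m^{-n}\#\mathbb T_n$ converges almost surely (and in $L^2$ when $\mathbb E[\nu^2]<\infty$) to a limit $W$, which is a.s. strictly positive with $\mathbb E[W]=1$. *)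

theory Defs
  imports "HOL-Probability.Probability"
begin

text \<open>Ulam--Harris encoding of a rooted tree: vertices are lists of natural numbers,
  the root is the empty list, the parent of a non-root vertex x is butlast x,
  and nu y is the number of children of y (children of y are y @ [i], i < nu y).
  A list x is a vertex of the tree iff each of its entries is a legal child index.\<close>

definition in_tree :: "(nat list \<Rightarrow> nat) \<Rightarrow> nat list \<Rightarrow> bool" where
  "in_tree nu x \<longleftrightarrow> (\<forall>i<length x. x ! i < nu (take i x))"

definition level :: "(nat list \<Rightarrow> nat) \<Rightarrow> nat \<Rightarrow> nat list set" where
  "level nu n = {x. length x = n \<and> in_tree nu x}"

text \<open>Effective conductance between the root and T_n in the tree with offspring
  function nu, where the edge {butlast x, x} (x a non-root vertex) carries resistance r x,
  defined through the Dirichlet variational principle: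
  the infimum of the energy over all potentials equal to 1 at the root and 0 on T_n.
  Only edges of depth at most n are relevant.\<close>
definition eff_conductance ::
  "(nat list \<Rightarrow> nat) \<Rightarrow> (nat list \<Rightarrow> real) \<Rightarrow> nat \<Rightarrow> real" where
  "eff_conductance nu r n =
     Inf {(\<Sum>x\<in>{x. in_tree nu x \<and> 1 \<le> length x \<and> length x \<le> n}.
              (f (butlast x) - f x)^2 / r x)
          | f :: nat list \<Rightarrow> real. f [] = 1 \<and> (\<forall>x\<in>level nu n. f x = 0)}"

end

theory Submission
  imports Defs
begin

text \<open>Let C_n be the conductance, let T f be the sum of f over the subtrees at the children of the
  root, divided by m, and let xi be the resistance variable of an edge. The series and parallel laws
  give C_(n+1) = T (C_n / (1 + xi C_n)), and T preserves means, while T^k contracts the second moment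
  of a centred f by m^(-k). Independence of xi and C_n together with a Chebyshev association
  inequality yields E[C_n^2] = O(E[C_n]^2), hence E[C_n] - E[C_(n+1)] = O(E[C_n]^2). Therefore
  T^j (C_n / E[C_n]) is close to T^j 1 = \<open>#\<close>T_j / m^j, and it differs from C_(n+j) / E[C_n]
  by a nonnegative quantity of mean O(j E[C_n]). Along a subsequence n_j with E[C_(n_j)] of order
  j^(-3) both errors are summable, which gives almost sure convergence there, and monotonicity of
  C_n in n fills the gaps because E[C_(n_(j+1))] / E[C_(n_j)] tends to 1.\<close>

section \<open>Recursion for the effective conductance\<close>

text \<open>The obstacle is the bound E[C_n^2] = O(E[C_n]^2). Write a_n for the mean and q_n for the
  second moment. The second moment q_(n+1) equals E[(C_n / (1 + xi C_n))^2] / m plus a multiple of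
  a_(n+1)^2. Bounding the first term by q_n / m makes q_n / a_n^2 contract only once a_(n+1) / a_n
  is known to be close to 1, and the available estimate a_n - a_(n+1) \<le> E[xi] q_n yields this
  only if q_n / a_n is small. The association inequality breaks the circle: it bounds the square
  mean by (q_n / a_n) a_(n+1), so q_n / a_n itself contracts, up to an error of order a_(n+1). For
  this a soft argument for a_n \<longlonglongrightarrow> 0 must come before any rate. A second
  difficulty is that only 1 / xi, not its square, is integrable. Second moments still exist from C_2
  on, because C_n / (1 + xi C_n) is at most C_n and at most 1 / xi, and these two bounds are
  independent.\<close>

lemma in_tree_Nil [simp]: "in_tree nu []"
  by (simp add: in_tree_def)

lemma in_tree_Cons:
  "in_tree nu (i # x) \<longleftrightarrow> i < nu [] \<and> in_tree (\<lambda>y. nu (i # y)) x"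
proof
  assume h: "in_tree nu (i # x)"
  have "i < nu []" using h by (auto simp: in_tree_def)
  moreover have "x ! j < nu (i # take j x)" if "j < length x" for j
    using h that unfolding in_tree_def by (auto dest: spec[of _ "Suc j"])
  ultimately show "i < nu [] \<and> in_tree (\<lambda>y. nu (i # y)) x"
    by (auto simp: in_tree_def)
next
  assume h: "i < nu [] \<and> in_tree (\<lambda>y. nu (i # y)) x"
  show "in_tree nu (i # x)" unfolding in_tree_def
  proof (intro allI impI)
    fix j assume "j < length (i # x)"
    then show "(i # x) ! j < nu (take j (i # x))"
      using h by (cases j) (auto simp: in_tree_def)
  qed
qed

text \<open>The index set of the sum in \<open>eff_conductance\<close>, named so that it can be
  decomposed along the first letter of a word.\<close>

definition edges :: "(nat list \<Rightarrow> nat) \<Rightarrow> nat \<Rightarrow> nat list set" where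
  "edges nu n = {x. in_tree nu x \<and> 1 \<le> length x \<and> length x \<le> n}"

lemma level_0 [simp]: "level nu 0 = {[]}"
  by (auto simp: level_def)

lemma level_Suc: "level nu (Suc n) = (\<Union>i<nu []. Cons i ` level (\<lambda>y. nu (i # y)) n)"
proof (rule set_eqI)
  fix x show "x \<in> level nu (Suc n) \<longleftrightarrow> x \<in> (\<Union>i<nu []. Cons i ` level (\<lambda>y. nu (i # y)) n)"
    by (cases x) (auto simp: level_def in_tree_Cons)
qed

lemma finite_level [simp]: "finite (level nu n)"
  by (induction n arbitrary: nu) (auto simp: level_Suc)

lemma card_level_Suc:
  "card (level nu (Suc n)) = (\<Sum>i<nu []. card (level (\<lambda>y. nu (i # y)) n))"
  unfolding level_Suc by (subst card_UN_disjoint) (auto simp: card_image)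

lemma edges_0 [simp]: "edges nu 0 = {}"
  by (auto simp: edges_def)

lemma edges_Suc:
  "edges nu (Suc n) = (\<Union>i<nu []. Cons i ` insert [] (edges (\<lambda>y. nu (i # y)) n))"
proof (rule set_eqI)
  fix x show "x \<in> edges nu (Suc n) \<longleftrightarrow>
      x \<in> (\<Union>i<nu []. Cons i ` insert [] (edges (\<lambda>y. nu (i # y)) n))"
  proof (cases x)
    case (Cons a y)
    show ?thesis unfolding Cons
      by (cases "y = []") (auto simp: edges_def in_tree_Cons Suc_le_eq image_iff)
  qed (auto simp: edges_def)
qed

lemma finite_edges [simp]: "finite (edges nu n)"
  by (induction n arbitrary: nu) (auto simp: edges_Suc)

lemma sum_edges_Suc:
  fixes F :: "nat list \<Rightarrow> real"
  shows "sum F (edges nu (Suc n)) =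
    (\<Sum>i<nu []. F [i] + (\<Sum>y\<in>edges (\<lambda>y. nu (i # y)) n. F (i # y)))"
proof -
  have "sum F (Cons i ` insert [] (edges (\<lambda>y. nu (i # y)) n)) =
      F [i] + (\<Sum>y\<in>edges (\<lambda>y. nu (i # y)) n. F (i # y))" for i
  proof -
    have "[] \<notin> edges (\<lambda>y. nu (i # y)) n" by (auto simp: edges_def)
    then show ?thesis by (subst sum.reindex) auto
  qed
  then show ?thesis unfolding edges_Suc
    by (subst sum.UNION_disjoint) auto
qed

section \<open>Environments and the series-parallel recursion\<close>

type_synonym env = "nat list + nat list \<Rightarrow> real"

text \<open>An environment stores the number of children of the vertex \<open>x\<close> at \<open>Inl x\<close>, as a real number so that
  all coordinates have one type, and the normalised resistance of the edge above \<open>x\<close> at \<open>Inr x\<close>.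
  The value at \<open>Inr []\<close> belongs to no edge of the tree; in a subtree it is the edge leading to it.\<close>

definition kids :: "env \<Rightarrow> nat list \<Rightarrow> nat" where
  "kids e x = nat \<lfloor>e (Inl x)\<rfloor>"

definition subenv :: "nat \<Rightarrow> env \<Rightarrow> env" where
  "subenv i e = (\<lambda>j. e (map_sum (Cons i) (Cons i) j))"

lemma subenv_simps [simp]:
  "subenv i e (Inl x) = e (Inl (i # x))" "subenv i e (Inr x) = e (Inr (i # x))"
  "kids (subenv i e) x = kids e (i # x)"
  by (simp_all add: subenv_def kids_def)

lemma kids_subenv: "kids (subenv i e) = (\<lambda>y. kids e (i # y))"
  by auto

text \<open>The operator T of the overview; its k-th power is \<open>1 / m ^ k\<close> times the sum
  over the vertices of level k. The factor \<open>1 / m\<close> has two origins that agree: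
  re-rooting at a child removes one factor \<open>m\<close> from every resistance, and
  \<open>m\<close> is the mean number of summands.\<close>

definition branch :: "real \<Rightarrow> (env \<Rightarrow> real) \<Rightarrow> env \<Rightarrow> real" where
  "branch m \<phi> e = (\<Sum>i<kids e []. \<phi> (subenv i e)) / m"

text \<open>Series connection of the edge stored at \<open>Inr []\<close> with a network of
  conductance \<open>\<phi> e\<close>, written without inverting \<open>\<phi> e\<close>.\<close>

definition through_edge :: "(env \<Rightarrow> real) \<Rightarrow> env \<Rightarrow> real" where
  "through_edge \<phi> e = \<phi> e / (1 + e (Inr []) * \<phi> e)"

text \<open>\<open>cond m n\<close> is the conductance between the root and level \<open>n + 1\<close>; the shift avoids the
  infinite conductance to level 0.\<close>

fun cond :: "real \<Rightarrow> nat \<Rightarrow> env \<Rightarrow> real" where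
  "cond m 0 = branch m (\<lambda>e. 1 / e (Inr []))"
| "cond m (Suc n) = branch m (through_edge (cond m n))"

definition energy :: "real \<Rightarrow> nat \<Rightarrow> env \<Rightarrow> (nat list \<Rightarrow> real) \<Rightarrow> real" where
  "energy m n e f =
     (\<Sum>x\<in>edges (kids e) n. (f (butlast x) - f x)^2 / (m ^ length x * e (Inr x)))"

lemma energy_0 [simp]: "energy m 0 e f = 0"
  by (simp add: energy_def)

lemma energy_Suc:
  "energy m (Suc n) e f =
    (\<Sum>i<kids e []. ((f [] - f [i])^2 / e (Inr [i]) + energy m n (subenv i e) (\<lambda>y. f (i # y))) / m)"
proof -
  have "(\<Sum>y\<in>edges (\<lambda>y. kids e (i # y)) n.
            (f (butlast (i # y)) - f (i # y))^2 / (m ^ length (i # y) * e (Inr (i # y))))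
        = energy m n (subenv i e) (\<lambda>y. f (i # y)) / m" for i
    unfolding energy_def kids_subenv sum_divide_distrib
    by (intro sum.cong) (auto simp: edges_def mult_ac)
  then show ?thesis
    unfolding energy_def[of m "Suc n" e f]
    by (subst sum_edges_Suc) (simp add: add_divide_distrib mult.commute)
qed

lemma cond_pos:
  assumes "m > 0" "\<And>x. e (Inr x) > 0" "\<And>x. kids e x > 0"
  shows "cond m n e > 0"
  using assms(2,3)
proof (induction n arbitrary: e)
  case 0
  have "{..<kids e []} \<noteq> {}" using 0(2)[of "[]"] by auto
  then have "0 < (\<Sum>i<kids e []. 1 / subenv i e (Inr []))" using 0(1) by (intro sum_pos) auto
  then show ?case using assms(1) by (simp add: branch_def)
next
  case (Suc n)
  have "cond m n (subenv i e) > 0" for i using Suc.prems by (intro Suc.IH) auto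
  moreover have "{..<kids e []} \<noteq> {}" using Suc.prems(2)[of "[]"] by auto
  ultimately show ?case using assms(1) Suc.prems
    by (auto simp: branch_def through_edge_def intro!: divide_pos_pos sum_pos add_pos_pos mult_pos_pos)
qed

lemma cond_nonneg:
  assumes "m > 0" "\<And>x. e (Inr x) > 0"
  shows "cond m n e \<ge> 0"
  using assms(2)
proof (induction n arbitrary: e)
  case 0
  then show ?case using assms(1)
    by (auto simp: branch_def less_imp_le intro!: divide_nonneg_pos sum_nonneg)
next
  case (Suc n)
  have "cond m n (subenv i e) \<ge> 0" for i using Suc.prems by (intro Suc.IH) auto
  then show ?case using assms(1) Suc.prems
    by (auto simp: branch_def through_edge_def less_imp_le intro!: divide_nonneg_pos sum_nonneg
        add_pos_nonneg mult_nonneg_nonneg)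
qed

text \<open>The difference of the two sides is a square divided by \<open>r * (1 + r * h)\<close>.
  It vanishes at \<open>t = s / (1 + r * h)\<close>, the voltage used in the equality case that
  follows.\<close>

lemma series_law_ge:
  fixes r h s t :: real
  assumes "r > 0" "h \<ge> 0"
  shows "(s - t)^2 / r + t^2 * h \<ge> s^2 * (h / (1 + r * h))"
proof -
  have d: "1 + r * h > 0" using assms by (simp add: add_pos_nonneg)
  have "(s - t)^2 / r + t^2 * h - s^2 * (h / (1 + r * h)) = (s - t * (1 + r * h))^2 / (r * (1 + r * h))"
    using assms(1) d by (simp add: field_simps power2_eq_square)
  also have "\<dots> \<ge> 0" using assms(1) d by simp
  finally show ?thesis by simp
qed

lemma series_law_eq:
  fixes r h s :: real
  assumes "r > 0" "h \<ge> 0"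
  shows "(s - s / (1 + r * h))^2 / r + (s / (1 + r * h))^2 * h = s^2 * (h / (1 + r * h))"
proof -
  have d: "1 + r * h > 0" using assms by (simp add: add_pos_nonneg)
  show ?thesis using assms(1) d
    by (simp add: divide_simps) (simp add: algebra_simps power2_eq_square)
qed

text \<open>The value at the root is left free, with its square as a factor, because a potential
  restricted to the subtree at a child has an arbitrary value there. Each child contributes one
  application of \<open>series_law_ge\<close>.\<close>

lemma energy_ge:
  assumes "m > 0" "\<And>x. e (Inr x) > 0" "\<And>x. x \<in> level (kids e) (Suc n) \<Longrightarrow> f x = 0"
  shows "energy m (Suc n) e f \<ge> (f [])^2 * cond m n e"
  using assms(2,3)
proof (induction n arbitrary: e f)
  case 0
  have z: "f [i] = 0" if "i < kids e []" for i
    using 0(2)[of "[i]"] that by (auto simp: level_Suc)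
  then show ?case using assms(1)
    by (auto simp: energy_Suc branch_def sum_divide_distrib sum_distrib_left intro!: sum_mono)
next
  case (Suc n)
  have IH: "energy m (Suc n) (subenv i e) (\<lambda>y. f (i # y)) \<ge> (f [i])^2 * cond m n (subenv i e)"
    if "i < kids e []" for i
    using Suc.prems that
    by (intro Suc.IH[where f = "\<lambda>y. f (i # y)" and e = "subenv i e"])
      (auto simp: level_Suc[of "kids e"] kids_subenv)
  have "(f [])^2 * cond m (Suc n) e = (\<Sum>i<kids e []. (f [])^2 * through_edge (cond m n) (subenv i e) / m)"
    by (simp add: branch_def sum_divide_distrib sum_distrib_left)
  also have "\<dots> \<le> (\<Sum>i<kids e []. ((f [] - f [i])^2 / e (Inr [i]) +
      energy m (Suc n) (subenv i e) (\<lambda>y. f (i # y))) / m)"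
  proof (intro sum_mono divide_right_mono)
    fix i assume i: "i \<in> {..<kids e []}"
    have "(f [])^2 * through_edge (cond m n) (subenv i e) \<le>
        (f [] - f [i])^2 / e (Inr [i]) + (f [i])^2 * cond m n (subenv i e)"
      unfolding through_edge_def subenv_simps
      by (rule series_law_ge) (use Suc.prems assms(1) in \<open>auto intro!: cond_nonneg\<close>)
    then show "(f [])^2 * through_edge (cond m n) (subenv i e) \<le> (f [] - f [i])^2 / e (Inr [i]) +
      energy m (Suc n) (subenv i e) (\<lambda>y. f (i # y))"
      using IH i by fastforce
  qed (use assms(1) in auto)
  finally show ?case by (simp only: energy_Suc[of m "Suc n"])
qed

lemma energy_attained:
  assumes "m > 0" "\<And>x. e (Inr x) > 0"
  shows "\<exists>f. f [] = s \<and> (\<forall>x\<in>level (kids e) (Suc n). f x = 0) \<and> energy m (Suc n) e f = s^2 * cond m n e"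
  using assms(2)
proof (induction n arbitrary: e s)
  case 0
  let ?f = "\<lambda>x. if x = [] then s else 0"
  have "energy m (Suc 0) e ?f = s^2 * cond m 0 e"
    by (simp add: energy_Suc branch_def sum_divide_distrib sum_distrib_left)
  then show ?case by (intro exI[of _ ?f]) (auto simp: level_def)
next
  case (Suc n)
  \<comment> \<open>The optimal voltage at child \<open>i\<close> from \<open>series_law_eq\<close>;
    the minimiser of the whole tree is glued from minimisers of the subtrees with these boundary
    values.\<close>
  define t where "t i = s / (1 + e (Inr [i]) * cond m n (subenv i e))" for i
  have "\<exists>f. f [] = t i \<and> (\<forall>x\<in>level (kids (subenv i e)) (Suc n). f x = 0) \<and>
      energy m (Suc n) (subenv i e) f = (t i)^2 * cond m n (subenv i e)" for i
    using Suc.prems by (intro Suc.IH) auto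
  then obtain F where F: "\<And>i. F i [] = t i"
      "\<And>i x. x \<in> level (kids (subenv i e)) (Suc n) \<Longrightarrow> F i x = 0"
      "\<And>i. energy m (Suc n) (subenv i e) (F i) = (t i)^2 * cond m n (subenv i e)"
    by metis
  define f where "f x = (case x of [] \<Rightarrow> s | i # y \<Rightarrow> F i y)" for x
  have f: "f [] = s" "f [i] = t i" "(\<lambda>y. f (i # y)) = F i" for i by (auto simp: f_def F)
  have "energy m (Suc (Suc n)) e f =
      (\<Sum>i<kids e []. ((s - t i)^2 / e (Inr [i]) + (t i)^2 * cond m n (subenv i e)) / m)"
    by (simp only: energy_Suc[of m "Suc n"] f F)
  also have "\<dots> = (\<Sum>i<kids e []. s^2 * through_edge (cond m n) (subenv i e) / m)"
    unfolding t_def through_edge_def subenv_simps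
    by (intro sum.cong refl arg_cong2[where f = "(/)"] series_law_eq)
      (use Suc.prems assms(1) in \<open>auto intro!: cond_nonneg\<close>)
  also have "\<dots> = s^2 * cond m (Suc n) e"
    by (simp add: branch_def sum_divide_distrib sum_distrib_left)
  finally have "energy m (Suc (Suc n)) e f = s^2 * cond m (Suc n) e" .
  moreover have "\<forall>x\<in>level (kids e) (Suc (Suc n)). f x = 0"
    using F(2) by (auto simp: level_Suc[of _ "Suc n"] kids_subenv f_def)
  ultimately show ?case using f(1) by blast
qed

lemma eff_conductance_eq_cond:
  assumes "m > 0" "\<And>x. e (Inr x) > 0"
  shows "eff_conductance (kids e) (\<lambda>x. m ^ length x * e (Inr x)) (Suc n) = cond m n e"
proof -
  obtain f where "f [] = 1" "\<forall>x\<in>level (kids e) (Suc n). f x = 0" "energy m (Suc n) e f = cond m n e"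
    using energy_attained[where s = 1 and e = e and n = n, OF assms(1)] assms(2) by auto
  then show ?thesis
    unfolding eff_conductance_def edges_def[symmetric] energy_def[symmetric]
    using energy_ge[where e = e and n = n, OF assms(1)] assms(2) by (intro cInf_eq_minimum) force+
qed

text \<open>The map sending \<open>c\<close> to \<open>c / (1 + r * c)\<close> is increasing and
  bounded by \<open>1 / r\<close>: the bound settles the base case, monotonicity the step.\<close>

lemma cond_Suc_le:
  assumes "m > 0" "\<And>x. e (Inr x) > 0"
  shows "cond m (Suc n) e \<le> cond m n e"
  using assms(2)
proof (induction n arbitrary: e)
  case 0
  have "through_edge (cond m 0) (subenv i e) \<le> 1 / subenv i e (Inr [])" for i
  proof -
    have "cond m 0 (subenv i e) \<ge> 0" using 0 assms(1) by (intro cond_nonneg) auto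
    then show ?thesis using 0[of "[i]"]
      by (simp add: through_edge_def divide_simps add_pos_nonneg mult.commute del: cond.simps)
  qed
  then show ?case using assms(1)
    by (simp only: cond.simps) (auto simp: branch_def simp del: cond.simps intro!: divide_right_mono sum_mono)
next
  case (Suc n)
  have "through_edge (cond m (Suc n)) (subenv i e) \<le> through_edge (cond m n) (subenv i e)" for i
  proof -
    have "cond m (Suc n) (subenv i e) \<le> cond m n (subenv i e)" using Suc by auto
    moreover have "cond m (Suc n) (subenv i e) \<ge> 0" "cond m n (subenv i e) \<ge> 0"
      using Suc assms(1) by (auto intro!: cond_nonneg simp del: cond.simps)
    moreover have "e (Inr [i]) > 0" using Suc by auto
    ultimately show ?thesis
      by (simp add: through_edge_def divide_simps add_pos_nonneg algebra_simps del: cond.simps)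
  qed
  then show ?case using assms(1)
    unfolding cond.simps(2)[of m "Suc n"] cond.simps(2)[of m n]
    by (auto simp: branch_def simp del: cond.simps intro!: divide_right_mono sum_mono)
qed

text \<open>Identifies the limit \<open>W\<close> with the limit of the iterates of
  \<open>branch\<close> on the constant 1, so that the tree and the conductance are governed by the
  same operator.\<close>

lemma card_level_eq_branch:
  "real (card (level (kids e) n)) / m ^ n = (branch m ^^ n) (\<lambda>_. 1) e"
proof (induction n arbitrary: e)
  case (Suc n)
  have "real (card (level (kids e) (Suc n))) / m ^ Suc n =
      (\<Sum>i<kids e []. real (card (level (kids (subenv i e)) n)) / m ^ n) / m"
    by (simp add: card_level_Suc kids_subenv sum_divide_distrib mult.commute)
  then show ?case by (simp only: Suc funpow.simps o_def branch_def)
qed simp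

section \<open>Measurability of the effective conductance\<close>

text \<open>This covers sets that are empty or unbounded below too: by its definition through the
  least upper bound of the negated set, \<open>Inf\<close> on the reals depends only on the set of
  lower bounds, whatever value it takes there.\<close>

lemma real_Inf_cong_lower_bounds:
  fixes S T :: "real set"
  assumes "\<And>z. (\<forall>x\<in>S. z \<le> x) \<longleftrightarrow> (\<forall>x\<in>T. z \<le> x)"
  shows "Inf S = Inf T"
proof -
  have "(\<forall>x\<in>uminus ` S. x \<le> z) \<longleftrightarrow> (\<forall>x\<in>uminus ` T. x \<le> z)" for z
    using assms[of "- z"] by auto
  then show ?thesis by (simp only: Inf_real_def Sup_real_def)
qed

text \<open>The random tree is replaced by a fixed vertex set \<open>A\<close>, so that the class of
  potentials no longer varies with the sample point.\<close>

definition potentials :: "nat list set \<Rightarrow> nat \<Rightarrow> (nat list \<Rightarrow> real) set" where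
  "potentials A n = {f. f [] = 1 \<and> (\<forall>x\<in>A. length x = n \<longrightarrow> f x = 0)}"

text \<open>The values that the Dirichlet sum and the root condition read are those on
  \<open>A\<close>, the parents and the root. Fixing the function outside this set makes the class
  countable for finite \<open>A\<close>.\<close>

definition rat_potentials :: "nat list set \<Rightarrow> nat \<Rightarrow> (nat list \<Rightarrow> real) set" where
  "rat_potentials A n = potentials A n \<inter> PiE (insert [] (A \<union> butlast ` A)) (\<lambda>_. \<rat>)"

definition dirichlet_sum :: "nat list set \<Rightarrow> (nat list \<Rightarrow> real) \<Rightarrow> (nat list \<Rightarrow> real) \<Rightarrow> real" where
  "dirichlet_sum A r f = (\<Sum>x\<in>{x\<in>A. x \<noteq> []}. (f (butlast x) - f x)^2 / r x)"

lemma eff_conductance_alt: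
  "eff_conductance nu r n = (INF f\<in>potentials {x. in_tree nu x \<and> length x \<le> n} n.
      dirichlet_sum {x. in_tree nu x \<and> length x \<le> n} r f)"
proof -
  have "{x. in_tree nu x \<and> 1 \<le> length x \<and> length x \<le> n} =
      {x \<in> {x. in_tree nu x \<and> length x \<le> n}. x \<noteq> []}"
    by (auto simp: Suc_le_eq)
  then show ?thesis
    unfolding eff_conductance_def dirichlet_sum_def potentials_def level_def
    by (intro arg_cong[where f = Inf]) auto
qed

text \<open>Rounding by the floor is exact at integers, so the boundary values 1 and 0 of a
  potential survive the approximation.\<close>

lemma rat_approximation:
  fixes t :: real
  shows "(\<lambda>k. of_int \<lfloor>real (Suc k) * t\<rfloor> / real (Suc k)) \<longlonglongrightarrow> t"
proof (rule tendsto_sandwich)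
  show "\<forall>\<^sub>F k in sequentially. t - 1 / real (Suc k) \<le> of_int \<lfloor>real (Suc k) * t\<rfloor> / real (Suc k)"
  proof (intro always_eventually allI)
    fix k
    have "real (Suc k) * t - 1 \<le> of_int \<lfloor>real (Suc k) * t\<rfloor>" by linarith
    then have "(real (Suc k) * t - 1) / real (Suc k) \<le> of_int \<lfloor>real (Suc k) * t\<rfloor> / real (Suc k)"
      by (intro divide_right_mono) auto
    then show "t - 1 / real (Suc k) \<le> of_int \<lfloor>real (Suc k) * t\<rfloor> / real (Suc k)"
      by (simp add: diff_divide_distrib)
  qed
  show "\<forall>\<^sub>F k in sequentially. of_int \<lfloor>real (Suc k) * t\<rfloor> / real (Suc k) \<le> t"
  proof (intro always_eventually allI)
    fix k
    have "of_int \<lfloor>real (Suc k) * t\<rfloor> \<le> real (Suc k) * t" by linarith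
    then show "of_int \<lfloor>real (Suc k) * t\<rfloor> / real (Suc k) \<le> t"
      by (simp add: divide_le_eq mult.commute)
  qed
  show "(\<lambda>k. t - 1 / real (Suc k)) \<longlonglongrightarrow> t"
    using tendsto_diff[OF tendsto_const[of t] LIMSEQ_inverse_real_of_nat]
    by (simp add: inverse_eq_divide)
qed auto

text \<open>The sum is a polynomial in finitely many values of the potential, so a lower bound on
  rational potentials passes to the limit. Signs of the resistances do not enter.\<close>

lemma Inf_rat_potentials:
  assumes "finite A"
  shows "(INF f\<in>potentials A n. dirichlet_sum A r f) = (INF f\<in>rat_potentials A n. dirichlet_sum A r f)"
proof (rule real_Inf_cong_lower_bounds, intro iffI ballI)
  fix z y assume "\<forall>x\<in>dirichlet_sum A r ` potentials A n. z \<le> x" "y \<in> dirichlet_sum A r ` rat_potentials A n"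
  then show "z \<le> y" by (auto simp: rat_potentials_def)
next
  fix z y assume z: "\<forall>x\<in>dirichlet_sum A r ` rat_potentials A n. z \<le> x" and "y \<in> dirichlet_sum A r ` potentials A n"
  then obtain f where f: "f \<in> potentials A n" "y = dirichlet_sum A r f" by auto
  let ?V = "insert [] (A \<union> butlast ` A)"
  define g where "g k = restrict (\<lambda>x. of_int \<lfloor>real (Suc k) * f x\<rfloor> / real (Suc k)) ?V" for k
  have "g k \<in> rat_potentials A n" for k
  proof -
    have "f [] = 1" using f by (auto simp: potentials_def)
    then have "g k [] = 1" by (simp add: g_def)
    then show ?thesis using f by (auto simp: potentials_def rat_potentials_def g_def)
  qed
  then have "z \<le> dirichlet_sum A r (g k)" for k using z by auto
  moreover have "(\<lambda>k. dirichlet_sum A r (g k)) \<longlonglongrightarrow> dirichlet_sum A r f"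
    unfolding dirichlet_sum_def divide_inverse
  proof (intro tendsto_intros)
    have g: "(\<lambda>k. g k x) \<longlonglongrightarrow> f x" if "x \<in> ?V" for x
      unfolding g_def using that rat_approximation[of "f x"] by simp
    fix x assume "x \<in> {x \<in> A. x \<noteq> []}"
    then show "(\<lambda>k. g k (butlast x)) \<longlonglongrightarrow> f (butlast x)" "(\<lambda>k. g k x) \<longlonglongrightarrow> f x"
      by (auto intro!: g)
  qed
  ultimately show "z \<le> y" unfolding f by (intro LIMSEQ_le_const) auto
qed

lemma countable_rat_potentials: "finite A \<Longrightarrow> countable (rat_potentials A n)"
  unfolding rat_potentials_def
  by (intro countable_Int2 countable_PiE) (auto simp: countable_rat)

lemma finite_in_tree: "finite {x. in_tree nu x \<and> length x \<le> n}"
proof -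
  have "{x. in_tree nu x \<and> length x \<le> n} \<subseteq> (\<Union>k\<le>n. level nu k)" by (auto simp: level_def)
  then show ?thesis by (rule finite_subset) auto
qed

text \<open>The resistances may be negative on a null set. There the infimum can be over a set that is
  unbounded below, so measurability (without which the Bochner integral of the conductance would be 0)
  is obtained from rational potentials and not from the recursion.\<close>

lemma measurable_eff_conductance:
  assumes [measurable]: "\<And>x. N x \<in> M \<rightarrow>\<^sub>M count_space UNIV" "\<And>x. R x \<in> borel_measurable M"
  shows "(\<lambda>\<omega>. eff_conductance (\<lambda>x. N x \<omega>) (\<lambda>x. R x \<omega>) n) \<in> borel_measurable M"
proof -
  define T where "T \<omega> = {x. in_tree (\<lambda>y. N y \<omega>) x \<and> length x \<le> n}" for \<omega>
  \<comment> \<open>The truncated tree takes values in the countable set of finite sets of words, so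
    measurability may be checked for each fixed tree.\<close>
  have T: "T \<in> M \<rightarrow>\<^sub>M count_space (Collect finite)"
  proof (subst measurable_count_space_eq_countable)
    show "countable (Collect finite :: nat list set set)" by (rule countable_Collect_finite)
    have "T -` {a} \<inter> space M = {\<omega>\<in>space M. \<forall>x. (in_tree (\<lambda>y. N y \<omega>) x \<and> length x \<le> n) = (x \<in> a)}" for a
      by (auto simp: T_def)
    also have "\<dots> a \<in> sets M" for a
    proof -
      have "Measurable.pred M (\<lambda>\<omega>. c < N y \<omega>)" for c y
        by (rule measurable_compose[OF assms(1)]) simp
      then have "Measurable.pred M (\<lambda>\<omega>. in_tree (\<lambda>y. N y \<omega>) x)" for x
        unfolding in_tree_def by (intro pred_intros_countable pred_intros_logic) auto
      then show ?thesis by measurable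
    qed
    finally show "T \<in> space M \<rightarrow> Collect finite \<and> (\<forall>a\<in>Collect finite. T -` {a} \<inter> space M \<in> sets M)"
      by (auto simp: T_def finite_in_tree)
  qed
  have "(\<lambda>\<omega>. INF f\<in>rat_potentials A n. dirichlet_sum A (\<lambda>x. R x \<omega>) f) \<in> borel_measurable M"
    if "A \<in> Collect finite" for A
    using that unfolding dirichlet_sum_def
    by (intro borel_measurable_cINF_real countable_rat_potentials) measurable
  then have "(\<lambda>\<omega>. INF f\<in>rat_potentials (T \<omega>) n. dirichlet_sum (T \<omega>) (\<lambda>x. R x \<omega>) f) \<in> borel_measurable M"
    by (rule measurable_compose_countable'[OF _ T countable_Collect_finite,
          where f = "\<lambda>A \<omega>. INF f\<in>rat_potentials A n. dirichlet_sum A (\<lambda>x. R x \<omega>) f"])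
  then show ?thesis
    unfolding eff_conductance_alt T_def by (simp add: Inf_rat_potentials finite_in_tree)
qed

section \<open>Moments of random sums\<close>

lemma measurable_indicator_at:
  "K \<in> M \<rightarrow>\<^sub>M count_space UNIV \<Longrightarrow> (\<lambda>\<omega>. indicator {k} (K \<omega>) :: real) \<in> borel_measurable M"
  by (rule measurable_compose[where N = "count_space UNIV"]) simp_all

lemma (in prob_space) expectation_indicator_at:
  "expectation (\<lambda>\<omega>. indicator {k} (K \<omega>) :: real) = prob {\<omega>\<in>space M. K \<omega> = k}"
proof -
  have "expectation (\<lambda>\<omega>. indicator {k} (K \<omega>) :: real) = expectation (indicator {\<omega>\<in>space M. K \<omega> = k})"
    by (intro Bochner_Integration.integral_cong) (auto split: split_indicator)
  also have "{\<omega> \<in> space M. K \<omega> = k} \<inter> space M = {\<omega> \<in> space M. K \<omega> = k}" by auto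
  then have "expectation (indicator {\<omega>\<in>space M. K \<omega> = k}) = prob {\<omega>\<in>space M. K \<omega> = k}"
    by simp
  finally show ?thesis .
qed

text \<open>Here \<open>w k\<close> is the conditional mean of \<open>F k\<close> given
  \<open>K = k\<close>. Splitting over the values of \<open>K\<close> and exchanging sum and
  integral, which nonnegativity permits, turns both expectations into the same series.\<close>

lemma (in prob_space) expectation_at_random_index:
  fixes F :: "nat \<Rightarrow> 'a \<Rightarrow> real" and w :: "nat \<Rightarrow> real"
  assumes K [measurable]: "K \<in> M \<rightarrow>\<^sub>M count_space UNIV"
    and F: "\<And>k. integrable M (F k)" "\<And>k \<omega>. F k \<omega> \<ge> 0"
    and w: "integrable M (\<lambda>\<omega>. w (K \<omega>))" "\<And>k. w k \<ge> 0"
    and eq: "\<And>k. expectation (\<lambda>\<omega>. indicator {k} (K \<omega>) * F k \<omega>) = prob {\<omega>\<in>space M. K \<omega> = k} * w k"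
  shows "integrable M (\<lambda>\<omega>. F (K \<omega>) \<omega>)"
    and "expectation (\<lambda>\<omega>. F (K \<omega>) \<omega>) = expectation (\<lambda>\<omega>. w (K \<omega>))"
proof -
  note [measurable] = measurable_indicator_at[OF K]
  have F_meas [measurable]: "F k \<in> borel_measurable M" for k using F(1) by auto
  have FK [measurable]: "(\<lambda>\<omega>. F (K \<omega>) \<omega>) \<in> borel_measurable M"
    by (rule measurable_compose_countable[OF F_meas K])
  have split: "(\<integral>\<^sup>+\<omega>. ennreal (G (K \<omega>) \<omega>) \<partial>M) =
      (\<Sum>k. ennreal (expectation (\<lambda>\<omega>. indicator {k} (K \<omega>) * G k \<omega>)))"
    if G: "\<And>k. integrable M (G k)" "\<And>k \<omega>. G k \<omega> \<ge> 0" for G :: "nat \<Rightarrow> 'a \<Rightarrow> real"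
  proof -
    have [measurable]: "G k \<in> borel_measurable M" for k using G(1) by auto
    have "(\<integral>\<^sup>+\<omega>. ennreal (G (K \<omega>) \<omega>) \<partial>M) =
        (\<integral>\<^sup>+\<omega>. (\<Sum>k. ennreal (indicator {k} (K \<omega>) * G k \<omega>)) \<partial>M)"
    proof (intro nn_integral_cong)
      fix \<omega>
      show "ennreal (G (K \<omega>) \<omega>) = (\<Sum>k. ennreal (indicator {k} (K \<omega>) * G k \<omega>))"
        by (subst suminf_finite[of "{K \<omega>}"]) auto
    qed
    also have "\<dots> = (\<Sum>k. \<integral>\<^sup>+\<omega>. ennreal (indicator {k} (K \<omega>) * G k \<omega>) \<partial>M)"
      by (intro nn_integral_suminf) measurable
    also have "\<dots> = (\<Sum>k. ennreal (expectation (\<lambda>\<omega>. indicator {k} (K \<omega>) * G k \<omega>)))"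
    proof (intro suminf_cong nn_integral_eq_integral)
      fix k
      show "integrable M (\<lambda>\<omega>. indicator {k} (K \<omega>) * G k \<omega>)"
        by (rule Bochner_Integration.integrable_bound[OF G(1)[of k]])
          (auto simp: G(2) split: split_indicator)
    qed (auto simp: G(2))
    finally show ?thesis .
  qed
  have ind: "expectation (\<lambda>\<omega>. indicator {k} (K \<omega>) * w k) = prob {\<omega>\<in>space M. K \<omega> = k} * w k" for k
    using expectation_indicator_at[of k K] by simp
  have "(\<integral>\<^sup>+\<omega>. ennreal (F (K \<omega>) \<omega>) \<partial>M) = (\<integral>\<^sup>+\<omega>. ennreal (w (K \<omega>)) \<partial>M)"
    by (simp only: split[of F, OF F] split[of "\<lambda>k _. w k", OF integrable_const w(2)] eq ind)
  also have "\<dots> = ennreal (expectation (\<lambda>\<omega>. w (K \<omega>)))"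
    using w by (intro nn_integral_eq_integral) auto
  finally have *: "(\<integral>\<^sup>+\<omega>. ennreal (F (K \<omega>) \<omega>) \<partial>M) = ennreal (expectation (\<lambda>\<omega>. w (K \<omega>)))" .
  show "integrable M (\<lambda>\<omega>. F (K \<omega>) \<omega>)"
    using F(2) by (intro integrableI_nn_integral_finite[OF _ _ *]) auto
  show "expectation (\<lambda>\<omega>. F (K \<omega>) \<omega>) = expectation (\<lambda>\<omega>. w (K \<omega>))"
    using w F(2) by (subst integral_eq_nn_integral)
      (auto simp: * intro!: enn2real_ennreal integral_nonneg_AE)
qed

text \<open>The joint independence of the count and all summands is expressed by one family over the
  naturals, with the count at index 0 and summand \<open>i\<close> at \<open>Suc i\<close>.\<close>

locale random_sum = prob_space +
  fixes K :: "'a \<Rightarrow> nat" and Y :: "nat \<Rightarrow> 'a \<Rightarrow> real"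
  assumes indep: "indep_vars (\<lambda>_. borel) (\<lambda>j. case j of 0 \<Rightarrow> (\<lambda>\<omega>. real (K \<omega>)) | Suc i \<Rightarrow> Y i) UNIV"
    and K_meas [measurable]: "K \<in> M \<rightarrow>\<^sub>M count_space UNIV"
    and K_int: "integrable M (\<lambda>\<omega>. real (K \<omega>))"
    and Y_int: "\<And>i. integrable M (Y i)"
begin

lemma indep_at:
  assumes [measurable]: "\<And>i. h i \<in> borel_measurable borel"
  shows "indep_vars (\<lambda>_. borel)
    (\<lambda>j. case j of 0 \<Rightarrow> (\<lambda>\<omega>. indicator {k} (K \<omega>)) | Suc i \<Rightarrow> (\<lambda>\<omega>. h i (Y i \<omega>) :: real)) UNIV"
proof -
  have "indep_vars (\<lambda>_. borel) (\<lambda>j \<omega>. (case j of 0 \<Rightarrow> indicator {real k} | Suc i \<Rightarrow> h i)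
      ((case j of 0 \<Rightarrow> (\<lambda>\<omega>. real (K \<omega>)) | Suc i \<Rightarrow> Y i) \<omega>)) UNIV"
    by (rule indep_vars_compose2[OF indep]) (auto split: nat.split)
  then show ?thesis
    by (rule indep_vars_cong[THEN iffD1, rotated -1])
      (auto split: nat.split simp: indicator_def fun_eq_iff)
qed

lemma integrable_indicator_K: "integrable M (\<lambda>\<omega>. indicator {k} (K \<omega>) :: real)"
  by (rule integrable_const_bound[of _ 1])
    (auto simp: measurable_indicator_at[OF K_meas] split: split_indicator)

lemma single:
  assumes [measurable]: "h \<in> borel_measurable borel" and i: "integrable M (\<lambda>\<omega>. h (Y i \<omega>))"
  shows "integrable M (\<lambda>\<omega>. indicator {k} (K \<omega>) * (h (Y i \<omega>) :: real))"
    and "expectation (\<lambda>\<omega>. indicator {k} (K \<omega>) * h (Y i \<omega>)) =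
      prob {\<omega>\<in>space M. K \<omega> = k} * expectation (\<lambda>\<omega>. h (Y i \<omega>))"
proof -
  note * = indep_vars_subset[OF indep_at[where h = "\<lambda>_. h" and k = k], of "{0, Suc i}"]
  have Z: "integrable M (case j of 0 \<Rightarrow> (\<lambda>\<omega>. indicator {k} (K \<omega>)) | Suc i \<Rightarrow> (\<lambda>\<omega>. h (Y i \<omega>)))"
    if "j \<in> {0, Suc i}" for j using that i integrable_indicator_K by auto
  show "integrable M (\<lambda>\<omega>. indicator {k} (K \<omega>) * h (Y i \<omega>))"
    using indep_vars_integrable[OF _ * Z] by simp
  show "expectation (\<lambda>\<omega>. indicator {k} (K \<omega>) * h (Y i \<omega>)) =
      prob {\<omega>\<in>space M. K \<omega> = k} * expectation (\<lambda>\<omega>. h (Y i \<omega>))"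
    using indep_vars_lebesgue_integral[OF _ * Z] by (simp add: expectation_indicator_at)
qed

lemma pair:
  assumes "i \<noteq> j"
  shows "integrable M (\<lambda>\<omega>. indicator {k} (K \<omega>) * (Y i \<omega> * Y j \<omega>))"
    and "integrable M (\<lambda>\<omega>. Y i \<omega> * Y j \<omega>)"
    and "expectation (\<lambda>\<omega>. indicator {k} (K \<omega>) * (Y i \<omega> * Y j \<omega>)) =
      prob {\<omega>\<in>space M. K \<omega> = k} * (expectation (Y i) * expectation (Y j))"
proof -
  note * = indep_vars_subset[OF indep_at[where h = "\<lambda>_ x. x" and k = k], of "{0, Suc i, Suc j}"]
  note ** = indep_vars_subset[OF indep_at[where h = "\<lambda>_ x. x" and k = k], of "{Suc i, Suc j}"]
  have Z: "integrable M (case l of 0 \<Rightarrow> (\<lambda>\<omega>. indicator {k} (K \<omega>)) | Suc i \<Rightarrow> (\<lambda>\<omega>. Y i \<omega>))" for l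
    using Y_int integrable_indicator_K by (auto split: nat.split)
  show "integrable M (\<lambda>\<omega>. indicator {k} (K \<omega>) * (Y i \<omega> * Y j \<omega>))"
    using indep_vars_integrable[OF _ * Z] assms by simp
  show "integrable M (\<lambda>\<omega>. Y i \<omega> * Y j \<omega>)"
    using indep_vars_integrable[OF _ ** Z] assms by simp
  show "expectation (\<lambda>\<omega>. indicator {k} (K \<omega>) * (Y i \<omega> * Y j \<omega>)) =
      prob {\<omega>\<in>space M. K \<omega> = k} * (expectation (Y i) * expectation (Y j))"
    using indep_vars_lebesgue_integral[OF _ * Z] assms by (simp add: expectation_indicator_at)
qed

text \<open>Wald's identity. Nonnegativity is what \<open>expectation_at_random_index\<close> asks
  for; signed summands are handled later by positive and negative parts.\<close>

lemma first_moment_nonneg: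
  assumes "\<And>i \<omega>. Y i \<omega> \<ge> 0" and a: "\<And>i. expectation (Y i) = a"
  shows "integrable M (\<lambda>\<omega>. \<Sum>i<K \<omega>. Y i \<omega>)"
    and "expectation (\<lambda>\<omega>. \<Sum>i<K \<omega>. Y i \<omega>) = expectation (\<lambda>\<omega>. real (K \<omega>)) * a"
proof -
  have a0: "a \<ge> 0" unfolding a[of 0, symmetric] using assms(1) by (intro integral_nonneg_AE) auto
  have "expectation (\<lambda>\<omega>. indicator {k} (K \<omega>) * (\<Sum>i<k. Y i \<omega>)) =
      prob {\<omega>\<in>space M. K \<omega> = k} * (real k * a)" for k
  proof -
    have "expectation (\<lambda>\<omega>. indicator {k} (K \<omega>) * (\<Sum>i<k. Y i \<omega>)) =
        (\<Sum>i<k. expectation (\<lambda>\<omega>. indicator {k} (K \<omega>) * Y i \<omega>))"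
      unfolding sum_distrib_left
      by (intro Bochner_Integration.integral_sum) (use single[where h = "\<lambda>x. x"] Y_int in auto)
    also have "\<dots> = (\<Sum>i<k. prob {\<omega>\<in>space M. K \<omega> = k} * a)"
      using single(2)[where h = "\<lambda>x. x" and k = k] Y_int by (simp add: a)
    finally show ?thesis by simp
  qed
  note * = expectation_at_random_index[of K "\<lambda>k \<omega>. \<Sum>i<k. Y i \<omega>" "\<lambda>k. real k * a", OF K_meas _ _ _ _ this]
  show "integrable M (\<lambda>\<omega>. \<Sum>i<K \<omega>. Y i \<omega>)"
    by (rule *(1)) (use a0 K_int Y_int assms(1) in \<open>auto intro!: sum_nonneg\<close>)
  have "expectation (\<lambda>\<omega>. \<Sum>i<K \<omega>. Y i \<omega>) = expectation (\<lambda>\<omega>. real (K \<omega>) * a)"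
    by (rule *(2)) (use a0 K_int Y_int assms(1) in \<open>auto intro!: sum_nonneg\<close>)
  then show "expectation (\<lambda>\<omega>. \<Sum>i<K \<omega>. Y i \<omega>) = expectation (\<lambda>\<omega>. real (K \<omega>)) * a" by simp
qed

text \<open>Given \<open>K = k\<close>, the square expands into \<open>k\<close> diagonal terms of
  mean \<open>b\<close> and \<open>k * (k - 1)\<close> mixed terms of mean \<open>a ^ 2\<close>; the
  weight \<open>w\<close> is this conditional second moment.\<close>

lemma second_moment:
  assumes a: "\<And>i. expectation (Y i) = a" and Y2: "\<And>i. integrable M (\<lambda>\<omega>. Y i \<omega> ^ 2)"
    and b: "\<And>i. expectation (\<lambda>\<omega>. Y i \<omega> ^ 2) = b" and K2: "integrable M (\<lambda>\<omega>. real (K \<omega>) ^ 2)"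
  shows "integrable M (\<lambda>\<omega>. (\<Sum>i<K \<omega>. Y i \<omega>) ^ 2)"
    and "expectation (\<lambda>\<omega>. (\<Sum>i<K \<omega>. Y i \<omega>) ^ 2) = expectation (\<lambda>\<omega>. real (K \<omega>)) * b
      + (expectation (\<lambda>\<omega>. real (K \<omega>) ^ 2) - expectation (\<lambda>\<omega>. real (K \<omega>))) * a ^ 2"
proof -
  have b0: "b \<ge> 0" unfolding b[of 0, symmetric] by (intro integral_nonneg_AE) auto
  define w where "w k = real k * b + (real k ^ 2 - real k) * a ^ 2" for k
  have w0: "w k \<ge> 0" for k
  proof -
    have "real k ^ 2 - real k \<ge> 0"
      by (cases k) (auto simp: power2_eq_square algebra_simps)
    then show ?thesis unfolding w_def using b0 by simp
  qed
  have wK: "integrable M (\<lambda>\<omega>. w (K \<omega>))" unfolding w_def using K_int K2 by auto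
  have sq: "(\<Sum>i<k. Y i \<omega>) ^ 2 = (\<Sum>i<k. \<Sum>j<k. Y i \<omega> * Y j \<omega>)" for k \<omega>
    by (simp add: power2_eq_square sum_product)
  have prod_int: "integrable M (\<lambda>\<omega>. Y i \<omega> * Y j \<omega>)"
      "integrable M (\<lambda>\<omega>. indicator {k} (K \<omega>) * (Y i \<omega> * Y j \<omega>))"
      "expectation (\<lambda>\<omega>. indicator {k} (K \<omega>) * (Y i \<omega> * Y j \<omega>)) =
        prob {\<omega>\<in>space M. K \<omega> = k} * (if i = j then b else a ^ 2)" for i j k
  proof -
    note s = single[where h = "\<lambda>x. x ^ 2" and i = i and k = k, OF _ Y2]
    show "integrable M (\<lambda>\<omega>. Y i \<omega> * Y j \<omega>)"
      using pair(2)[of i j] Y2[of i] by (cases "i = j") (auto simp: power2_eq_square)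
    show "integrable M (\<lambda>\<omega>. indicator {k} (K \<omega>) * (Y i \<omega> * Y j \<omega>))"
      using pair(1)[of i j k] s(1) by (cases "i = j") (auto simp: power2_eq_square)
    show "expectation (\<lambda>\<omega>. indicator {k} (K \<omega>) * (Y i \<omega> * Y j \<omega>)) =
        prob {\<omega>\<in>space M. K \<omega> = k} * (if i = j then b else a ^ 2)"
    proof (cases "i = j")
      case True
      then show ?thesis using s(2) b[of i] by (simp add: power2_eq_square)
    next
      case False
      then show ?thesis using pair(3)[of i j k] by (simp add: a power2_eq_square)
    qed
  qed
  have F_int: "integrable M (\<lambda>\<omega>. (\<Sum>i<k. Y i \<omega>) ^ 2)" for k
    unfolding sq using prod_int(1) by auto
  have row: "(\<Sum>j<k. if i = j then b else a ^ 2) = b + (real k - 1) * a ^ 2" if "i < k" for i k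
    using that by (subst sum.remove[of _ i]) (auto simp: of_nat_diff)
  have "expectation (\<lambda>\<omega>. indicator {k} (K \<omega>) * (\<Sum>i<k. Y i \<omega>) ^ 2) =
      prob {\<omega>\<in>space M. K \<omega> = k} * (\<Sum>i<k. \<Sum>j<k. if i = j then b else a ^ 2)" for k
  proof -
    have "expectation (\<lambda>\<omega>. indicator {k} (K \<omega>) * (\<Sum>i<k. Y i \<omega>) ^ 2) =
        (\<Sum>i<k. expectation (\<lambda>\<omega>. \<Sum>j<k. indicator {k} (K \<omega>) * (Y i \<omega> * Y j \<omega>)))"
      unfolding sq sum_distrib_left
      by (intro Bochner_Integration.integral_sum Bochner_Integration.integrable_sum prod_int)
    also have "\<dots> = (\<Sum>i<k. \<Sum>j<k. expectation (\<lambda>\<omega>. indicator {k} (K \<omega>) * (Y i \<omega> * Y j \<omega>)))"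
      by (intro sum.cong refl Bochner_Integration.integral_sum prod_int)
    finally have "expectation (\<lambda>\<omega>. indicator {k} (K \<omega>) * (\<Sum>i<k. Y i \<omega>) ^ 2) =
        (\<Sum>i<k. \<Sum>j<k. expectation (\<lambda>\<omega>. indicator {k} (K \<omega>) * (Y i \<omega> * Y j \<omega>)))" .
    then show ?thesis by (simp only: prod_int sum_distrib_left)
  qed
  also have "(\<Sum>i<k. \<Sum>j<k. if i = j then b else a ^ 2) = w k" for k
    unfolding w_def by (simp add: row) (simp add: algebra_simps power2_eq_square)
  finally have "expectation (\<lambda>\<omega>. indicator {k} (K \<omega>) * (\<Sum>i<k. Y i \<omega>) ^ 2) =
      prob {\<omega>\<in>space M. K \<omega> = k} * w k" for k .
  note * = expectation_at_random_index[of K "\<lambda>k \<omega>. (\<Sum>i<k. Y i \<omega>) ^ 2" w, OF K_meas F_int _ wK w0 this]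
  show "integrable M (\<lambda>\<omega>. (\<Sum>i<K \<omega>. Y i \<omega>) ^ 2)" by (rule *(1)) auto
  have "expectation (\<lambda>\<omega>. (\<Sum>i<K \<omega>. Y i \<omega>) ^ 2) = expectation (\<lambda>\<omega>. w (K \<omega>))"
    by (rule *(2)) auto
  then show "expectation (\<lambda>\<omega>. (\<Sum>i<K \<omega>. Y i \<omega>) ^ 2) = expectation (\<lambda>\<omega>. real (K \<omega>)) * b
      + (expectation (\<lambda>\<omega>. real (K \<omega>) ^ 2) - expectation (\<lambda>\<omega>. real (K \<omega>))) * a ^ 2"
    unfolding w_def using K_int K2 by simp
qed

end

section \<open>The canonical space of environments\<close>

text \<open>Only the two laws enter. The product space over all words, inside the tree or not,
  replaces the given space because passing to the subtree at a child is then a map of the space into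
  itself, and \<open>branch\<close> can be iterated on functions.\<close>

locale galton_watson_env =
  fixes p :: "nat pmf" and \<eta> :: "real measure" and m :: real
  assumes prob_eta: "prob_space \<eta>" and sets_eta [measurable_cong]: "sets \<eta> = sets borel"
    and p0: "pmf p 0 = 0"
    and p_square: "integrable (measure_pmf p) (\<lambda>k. real k ^ 2)"
    and m_def: "m = measure_pmf.expectation p real"
    and m_gt1: "m > 1"
    and eta_pos: "AE x in \<eta>. x > 0"
    and eta_int: "integrable \<eta> (\<lambda>x. x)"
    and eta_inv_int: "integrable \<eta> (\<lambda>x. 1 / x)"
begin

definition coord_law :: "nat list + nat list \<Rightarrow> real measure" where
  "coord_law j = (case j of Inl _ \<Rightarrow> distr (measure_pmf p) borel real | Inr _ \<Rightarrow> \<eta>)"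

definition \<mu> :: "env measure" where
  "\<mu> = PiM UNIV coord_law"

lemma prob_coord_law: "prob_space (coord_law j)"
  unfolding coord_law_def using prob_eta
  by (auto split: sum.split intro!: prob_space.prob_space_distr measure_pmf.prob_space_axioms)

lemma sets_coord_law [measurable_cong]: "sets (coord_law j) = sets borel"
  unfolding coord_law_def using sets_eta by (auto split: sum.split)

lemma space_mu [simp]: "space \<mu> = UNIV"
proof -
  have "space (coord_law j) = UNIV" for j using sets_eq_imp_space_eq[OF sets_coord_law] by simp
  then show ?thesis by (auto simp: \<mu>_def space_PiM)
qed

sublocale prob_space \<mu>
  unfolding \<mu>_def by (intro prob_space_PiM prob_coord_law)

lemma sets_mu [measurable_cong]: "sets \<mu> = sets (PiM UNIV (\<lambda>_. borel))"
  unfolding \<mu>_def by (intro sets_PiM_cong sets_coord_law refl)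

lemma measurable_coord [measurable]: "(\<lambda>e. e j) \<in> borel_measurable \<mu>"
  by measurable

lemma distr_coord: "distr \<mu> borel (\<lambda>e. e j) = coord_law j"
proof -
  have "distr \<mu> borel (\<lambda>e. e j) = distr \<mu> (coord_law j) (\<lambda>e. e j)"
    by (intro distr_cong) (auto simp: sets_coord_law)
  also have "\<dots> = coord_law j"
    unfolding \<mu>_def by (rule distr_PiM_component[OF prob_coord_law]) simp
  finally show ?thesis .
qed

lemma indep_coords: "indep_vars (\<lambda>_. borel) (\<lambda>j e. e j) UNIV"
proof (subst indep_vars_iff_distr_eq_PiM')
  have "distr \<mu> (PiM UNIV (\<lambda>_. borel)) (\<lambda>e. \<lambda>i\<in>UNIV. e i) = distr \<mu> \<mu> (\<lambda>e. e)"
    by (intro distr_cong) (auto simp: sets_mu)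
  also have "\<dots> = \<mu>" by (rule distr_id2) simp
  finally show "distr \<mu> (PiM UNIV (\<lambda>_. borel)) (\<lambda>e. \<lambda>i\<in>UNIV. e i) = PiM UNIV (\<lambda>i. distr \<mu> borel (\<lambda>e. e i))"
    by (simp add: distr_coord) (simp add: \<mu>_def)
qed auto

lemma measurable_subenv [measurable]: "subenv i \<in> \<mu> \<rightarrow>\<^sub>M \<mu>"
proof -
  have "subenv i \<in> \<mu> \<rightarrow>\<^sub>M PiM UNIV (\<lambda>_. borel)"
    unfolding subenv_def by (rule measurable_PiM_single') (auto simp: space_PiM)
  then show ?thesis by (simp cong: measurable_cong_sets add: sets_mu)
qed

text \<open>Prefixing a letter is an injective change of index that keeps the law of each
  coordinate, so it carries the product measure to itself.\<close>

lemma distr_subenv: "distr \<mu> \<mu> (subenv i) = \<mu>"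
proof -
  have "inj (map_sum (Cons i) (Cons i))" by (intro sum.inj_map) (auto simp: inj_on_def)
  moreover have "coord_law (map_sum (Cons i) (Cons i) j) = coord_law j" for j
    by (auto simp: coord_law_def split: sum.split)
  ultimately show ?thesis
    using distr_PiM_reindex[of UNIV coord_law "map_sum (Cons i) (Cons i)" UNIV, OF prob_coord_law]
    by (simp add: \<mu>_def subenv_def[abs_def] restrict_def)
qed

lemma measurable_kids [measurable]: "(\<lambda>e. kids e x) \<in> \<mu> \<rightarrow>\<^sub>M count_space UNIV"
  unfolding kids_def by measurable

lemma distr_kids: "distr \<mu> (count_space UNIV) (\<lambda>e. kids e x) = measure_pmf p"
proof -
  have "distr \<mu> (count_space UNIV) (\<lambda>e. kids e x) =
      distr (distr \<mu> borel (\<lambda>e. e (Inl x))) (count_space UNIV) (\<lambda>r. nat \<lfloor>r\<rfloor>)"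
    by (subst distr_distr) (auto simp: kids_def o_def)
  also have "\<dots> = measure_pmf p"
    unfolding distr_coord coord_law_def
    by (simp add: distr_distr o_def distr_id2)
  finally show ?thesis .
qed

lemma distr_resistance: "distr \<mu> borel (\<lambda>e. e (Inr x)) = \<eta>"
  unfolding distr_coord coord_law_def by simp

lemma integral_kids: "expectation (\<lambda>e. f (kids e x)) = measure_pmf.expectation p f" for f :: "nat \<Rightarrow> real"
  by (subst distr_kids[of x, symmetric]) (simp add: integral_distr)

lemma integrable_kids: "integrable \<mu> (\<lambda>e. f (kids e x)) \<longleftrightarrow> integrable (measure_pmf p) f" for f :: "nat \<Rightarrow> real"
  by (subst distr_kids[of x, symmetric]) (simp add: integrable_distr_eq)

lemma integrable_p: "integrable (measure_pmf p) real"
  by (rule Bochner_Integration.integrable_bound[OF p_square])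
    (auto simp: power2_eq_square intro!: AE_I2 simp flip: of_nat_mult)

text \<open>The event on which the pointwise estimates hold. Positivity is imposed at every word,
  not only at vertices of the tree, which makes the set stable under every
  \<open>subenv i\<close>.\<close>

definition good :: "env set" where
  "good = {e. (\<forall>x. e (Inr x) > 0) \<and> (\<forall>x. kids e x > 0)}"

lemma AE_good: "AE e in \<mu>. e \<in> good"
proof -
  have "AE e in \<mu>. e (Inr x) > 0" for x
    using eta_pos by (subst (asm) distr_resistance[of x, symmetric]) (simp add: AE_distr_iff)
  moreover have "AE e in \<mu>. kids e x > 0" for x
  proof -
    have "AE k in measure_pmf p. k > 0"
      using p0 by (auto simp: AE_measure_pmf_iff set_pmf_iff intro!: Nat.gr0I)
    then show ?thesis
      by (subst (asm) distr_kids[of x, symmetric]) (simp add: AE_distr_iff)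
  qed
  ultimately show ?thesis by (simp add: good_def AE_all_countable)
qed

lemma good_subenv: "e \<in> good \<Longrightarrow> subenv i e \<in> good"
  by (auto simp: good_def)

section \<open>The branching operator: measurability, independence and moments\<close>

lemma measurable_branch [measurable]:
  assumes [measurable]: "\<phi> \<in> borel_measurable \<mu>"
  shows "branch m \<phi> \<in> borel_measurable \<mu>"
proof -
  have "(\<lambda>e. \<Sum>i<kids e []. \<phi> (subenv i e)) \<in> borel_measurable \<mu>"
    by (rule measurable_compose_countable[where f = "\<lambda>k e. \<Sum>i<k. \<phi> (subenv i e)"]) measurable
  then show ?thesis unfolding branch_def[abs_def] by measurable
qed

lemma measurable_branch_pow [measurable]:
  "\<phi> \<in> borel_measurable \<mu> \<Longrightarrow> (branch m ^^ k) \<phi> \<in> borel_measurable \<mu>"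
  by (induction k) auto

lemma measurable_through_edge [measurable]:
  assumes [measurable]: "\<phi> \<in> borel_measurable \<mu>"
  shows "through_edge \<phi> \<in> borel_measurable \<mu>"
  unfolding through_edge_def[abs_def] by measurable

lemma measurable_cond [measurable]: "cond m n \<in> borel_measurable \<mu>"
  by (induction n) auto

lemma integrable_subenv:
  fixes f :: "env \<Rightarrow> real"
  assumes [measurable]: "f \<in> borel_measurable \<mu>"
  shows "integrable \<mu> (\<lambda>e. f (subenv i e)) \<longleftrightarrow> integrable \<mu> f"
  using integrable_distr_eq[of "subenv i" \<mu> \<mu> f] by (simp add: distr_subenv)

lemma expectation_subenv:
  fixes f :: "env \<Rightarrow> real"
  assumes [measurable]: "f \<in> borel_measurable \<mu>"
  shows "expectation (\<lambda>e. f (subenv i e)) = expectation f"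
  using integral_distr[of "subenv i" \<mu> \<mu> f] by (simp add: distr_subenv)

text \<open>The offspring number of the root and the subtrees read disjoint blocks of coordinates:
  \<open>Inl []\<close>, and for each \<open>i\<close> the words that begin with
  \<open>i\<close>.\<close>

lemma indep_root_subenv:
  assumes [measurable]: "\<phi> \<in> borel_measurable \<mu>"
  shows "indep_vars (\<lambda>_. borel)
    (\<lambda>j. case j of 0 \<Rightarrow> (\<lambda>e. real (kids e [])) | Suc i \<Rightarrow> (\<lambda>e. \<phi> (subenv i e))) UNIV"
proof -
  define B :: "nat \<Rightarrow> (nat list + nat list) set" where
    "B j = (case j of 0 \<Rightarrow> {Inl []} | Suc i \<Rightarrow> range (map_sum (Cons i) (Cons i)))" for j
  define h :: "nat \<Rightarrow> env \<Rightarrow> real" where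
    "h j = (case j of 0 \<Rightarrow> (\<lambda>e. real (nat \<lfloor>e (Inl [])\<rfloor>)) | Suc i \<Rightarrow> (\<lambda>e. \<phi> (subenv i e)))" for j
  have "B i \<inter> B j = {}" if "i \<noteq> j" for i j
  proof -
    have "Inl [] \<noteq> map_sum (Cons i) (Cons i) s" for i :: nat and s :: "nat list + nat list"
      by (cases s) auto
    moreover have "map_sum (Cons i) (Cons i) s \<noteq> map_sum (Cons j) (Cons j) t" if "i \<noteq> j"
      for i j :: nat and s t :: "nat list + nat list"
      using that by (cases s; cases t) auto
    ultimately show ?thesis using that unfolding B_def by (auto split: nat.split)
  qed
  then have "disjoint_family_on B UNIV" by (auto simp: disjoint_family_on_def)
  then have ind: "indep_vars (\<lambda>j. PiM (B j) (\<lambda>_. borel)) (\<lambda>j e. restrict (\<lambda>i. e i) (B j)) UNIV"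
    by (intro indep_vars_restrict[OF indep_coords]) auto
  have h_meas: "h j \<in> borel_measurable (PiM (B j) (\<lambda>_. borel))" for j
  proof (cases j)
    case 0
    then have "(\<lambda>e::env. e (Inl [])) \<in> borel_measurable (PiM (B j) (\<lambda>_. borel))"
      by (intro measurable_component_singleton) (auto simp: B_def)
    then have "(\<lambda>e::env. real (nat \<lfloor>e (Inl [])\<rfloor>)) \<in> borel_measurable (PiM (B j) (\<lambda>_. borel))"
      by (rule measurable_compose) measurable
    then show ?thesis using 0 by (simp add: h_def)
  next
    case (Suc i)
    have "subenv i \<in> PiM (B j) (\<lambda>_. borel) \<rightarrow>\<^sub>M PiM UNIV (\<lambda>_. borel)"
      unfolding subenv_def
      by (rule measurable_PiM_single') (auto simp: space_PiM B_def Suc intro!: measurable_component_singleton)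
    then have "subenv i \<in> PiM (B j) (\<lambda>_. borel) \<rightarrow>\<^sub>M \<mu>"
      by (simp cong: measurable_cong_sets add: sets_mu)
    then have "(\<lambda>e. \<phi> (subenv i e)) \<in> borel_measurable (PiM (B j) (\<lambda>_. borel))"
      by (rule measurable_compose) simp
    then show ?thesis by (simp add: h_def Suc)
  qed
  have "indep_vars (\<lambda>_. borel) (\<lambda>j e. h j (restrict (\<lambda>i. e i) (B j))) UNIV"
    by (rule indep_vars_compose2[OF ind]) (use h_meas in auto)
  moreover have "h j (restrict (\<lambda>i. e i) (B j)) =
      (case j of 0 \<Rightarrow> (\<lambda>e. real (kids e [])) | Suc i \<Rightarrow> (\<lambda>e. \<phi> (subenv i e))) e" for j e
  proof (cases j)
    case (Suc i)
    have "subenv i (restrict e (B j)) = subenv i e" by (auto simp: subenv_def B_def Suc)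
    then show ?thesis by (simp add: h_def Suc)
  qed (simp add: h_def B_def kids_def)
  ultimately show ?thesis by simp
qed

lemma random_sum_subenv:
  assumes [measurable]: "\<phi> \<in> borel_measurable \<mu>" and "integrable \<mu> \<phi>"
  shows "random_sum \<mu> (\<lambda>e. kids e []) (\<lambda>i e. \<phi> (subenv i e))"
proof unfold_locales
  show "integrable \<mu> (\<lambda>e. real (kids e []))"
    by (subst integrable_kids[where f = real]) (rule integrable_p)
qed (use assms in \<open>auto simp: integrable_subenv intro!: indep_root_subenv\<close>)

lemma m_pos: "m > 0" using m_gt1 by simp

lemma branch_diff: "branch m (\<lambda>e. f e - g e) e = branch m f e - branch m g e"
  by (simp add: branch_def sum_subtractf diff_divide_distrib)

lemma branch_nonneg_moment:
  assumes [measurable]: "\<phi> \<in> borel_measurable \<mu>" and "integrable \<mu> \<phi>" "\<And>e. \<phi> e \<ge> 0"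
  shows "integrable \<mu> (branch m \<phi>)" "expectation (branch m \<phi>) = expectation \<phi>"
proof -
  interpret R: random_sum \<mu> "\<lambda>e. kids e []" "\<lambda>i e. \<phi> (subenv i e)"
    by (rule random_sum_subenv) fact+
  have EK: "expectation (\<lambda>e. real (kids e [])) = m"
    using integral_kids[of real] by (simp add: m_def)
  note * = R.first_moment_nonneg[OF assms(3) expectation_subenv]
  show "integrable \<mu> (branch m \<phi>)" unfolding branch_def[abs_def] using *(1) by simp
  show "expectation (branch m \<phi>) = expectation \<phi>"
    unfolding branch_def[abs_def] using *(2) m_pos by (simp add: EK)
qed

lemma branch_moment:
  assumes [measurable]: "\<phi> \<in> borel_measurable \<mu>" and "integrable \<mu> \<phi>"
  shows "integrable \<mu> (branch m \<phi>)" "expectation (branch m \<phi>) = expectation \<phi>"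
proof -
  define P where "P e = max 0 (\<phi> e)" for e
  define Q where "Q e = max 0 (- \<phi> e)" for e
  have PQ: "\<phi> = (\<lambda>e. P e - Q e)" by (auto simp: P_def Q_def)
  have [measurable]: "P \<in> borel_measurable \<mu>" "Q \<in> borel_measurable \<mu>"
    unfolding P_def[abs_def] Q_def[abs_def] by auto
  have int: "integrable \<mu> P" "integrable \<mu> Q"
    unfolding P_def[abs_def] Q_def[abs_def] using assms(2) by auto
  have "P e \<ge> 0" "Q e \<ge> 0" for e by (auto simp: P_def Q_def)
  note * = branch_nonneg_moment[OF _ int(1) this(1)] branch_nonneg_moment[OF _ int(2) this(2)]
  have b: "branch m \<phi> = (\<lambda>e. branch m P e - branch m Q e)"
    unfolding PQ by (rule ext) (rule branch_diff)
  show "integrable \<mu> (branch m \<phi>)" unfolding b using * by auto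
  show "expectation (branch m \<phi>) = expectation \<phi>" unfolding b
    by (subst PQ) (use * int in simp)
qed

text \<open>The normalised factorial moment E[nu (nu - 1)] / m^2, the weight with which pairs of
  distinct children enter the second moment of \<open>branch m \<phi>\<close>.\<close>

definition \<kappa> :: real where
  "\<kappa> = (measure_pmf.expectation p (\<lambda>k. real k ^ 2) - m) / m ^ 2"

lemma integrable_of_square:
  fixes f :: "env \<Rightarrow> real"
  assumes [measurable]: "f \<in> borel_measurable \<mu>" and "integrable \<mu> (\<lambda>e. f e ^ 2)"
  shows "integrable \<mu> f"
proof (rule Bochner_Integration.integrable_bound[of _ "\<lambda>e. 1 + f e ^ 2"])
  have "norm t \<le> norm (1 + t ^ 2)" for t :: real
  proof -
    have "0 \<le> (\<bar>t\<bar> - 1) ^ 2" by simp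
    then have "2 * \<bar>t\<bar> \<le> 1 + t ^ 2" by (simp add: power2_diff)
    then show ?thesis by simp
  qed
  then show "AE e in \<mu>. norm (f e) \<le> norm (1 + f e ^ 2)" by simp
qed (use assms in auto)

lemma branch_square:
  assumes [measurable]: "\<phi> \<in> borel_measurable \<mu>" and "integrable \<mu> (\<lambda>e. \<phi> e ^ 2)"
  shows "integrable \<mu> (\<lambda>e. branch m \<phi> e ^ 2)"
    "expectation (\<lambda>e. branch m \<phi> e ^ 2) = expectation (\<lambda>e. \<phi> e ^ 2) / m + \<kappa> * expectation \<phi> ^ 2"
proof -
  interpret R: random_sum \<mu> "\<lambda>e. kids e []" "\<lambda>i e. \<phi> (subenv i e)"
    using integrable_of_square[OF assms] by (intro random_sum_subenv) auto
  have EK: "expectation (\<lambda>e. real (kids e [])) = m"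
      "expectation (\<lambda>e. real (kids e []) ^ 2) = measure_pmf.expectation p (\<lambda>k. real k ^ 2)"
    using integral_kids[of real] integral_kids[of "\<lambda>k. real k ^ 2"] by (simp_all add: m_def)
  have K2: "integrable \<mu> (\<lambda>e. real (kids e []) ^ 2)"
    using integrable_kids[of "\<lambda>k. real k ^ 2"] p_square by simp
  have i: "integrable \<mu> (\<lambda>e. (\<phi> (subenv i e)) ^ 2)" for i
    using integrable_subenv[of "\<lambda>e. \<phi> e ^ 2"] assms by simp
  note * = R.second_moment[OF expectation_subenv i expectation_subenv[of "\<lambda>e. \<phi> e ^ 2"] K2]
  show "integrable \<mu> (\<lambda>e. branch m \<phi> e ^ 2)"
    unfolding branch_def[abs_def] power_divide using *(1) by simp
  show "expectation (\<lambda>e. branch m \<phi> e ^ 2) = expectation (\<lambda>e. \<phi> e ^ 2) / m + \<kappa> * expectation \<phi> ^ 2"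
  proof -
    have "m * x / m ^ 2 = x / m" for x using m_pos by (simp add: power2_eq_square)
    then show ?thesis
      unfolding branch_def[abs_def] power_divide using *(2) by (simp add: EK \<kappa>_def add_divide_distrib)
  qed
qed

lemma branch_pow_moment:
  assumes [measurable]: "\<phi> \<in> borel_measurable \<mu>" and "integrable \<mu> \<phi>"
  shows "integrable \<mu> ((branch m ^^ k) \<phi>)" "expectation ((branch m ^^ k) \<phi>) = expectation \<phi>"
proof -
  have "integrable \<mu> ((branch m ^^ k) \<phi>) \<and> expectation ((branch m ^^ k) \<phi>) = expectation \<phi>"
    by (induction k) (use assms branch_moment in auto)
  then show "integrable \<mu> ((branch m ^^ k) \<phi>)" "expectation ((branch m ^^ k) \<phi>) = expectation \<phi>" by auto
qed

text \<open>The mean stays 0 under iteration, so the \<open>\<kappa>\<close> term of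
  \<open>branch_square\<close> vanishes at every step and only the division by \<open>m\<close> is
  left.\<close>

lemma branch_pow_centred_square:
  assumes [measurable]: "\<phi> \<in> borel_measurable \<mu>" and \<phi>: "integrable \<mu> (\<lambda>e. \<phi> e ^ 2)" "expectation \<phi> = 0"
  shows "integrable \<mu> (\<lambda>e. (branch m ^^ k) \<phi> e ^ 2)"
    "expectation (\<lambda>e. (branch m ^^ k) \<phi> e ^ 2) = expectation (\<lambda>e. \<phi> e ^ 2) / m ^ k"
proof -
  have "integrable \<mu> (\<lambda>e. (branch m ^^ k) \<phi> e ^ 2) \<and>
    expectation (\<lambda>e. (branch m ^^ k) \<phi> e ^ 2) = expectation (\<lambda>e. \<phi> e ^ 2) / m ^ k"
  proof (induction k)
    case (Suc k)
    have "expectation ((branch m ^^ k) \<phi>) = 0"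
      by (simp only: branch_pow_moment(2)[OF assms(1) integrable_of_square[OF assms(1) \<phi>(1)]] \<phi>(2))
    then show ?case
      using branch_square[OF measurable_branch_pow[OF assms(1)], of k] Suc
      by (simp add: mult.commute)
  qed (use \<phi> in auto)
  then show "integrable \<mu> (\<lambda>e. (branch m ^^ k) \<phi> e ^ 2)"
    "expectation (\<lambda>e. (branch m ^^ k) \<phi> e ^ 2) = expectation (\<lambda>e. \<phi> e ^ 2) / m ^ k" by auto
qed

text \<open>The value of \<open>branch m \<phi>\<close> depends on the offspring number of the root
  and on words of positive length, never on the coordinate \<open>Inr []\<close>.\<close>

lemma indep_root_edge_branch:
  assumes [measurable]: "\<phi> \<in> borel_measurable \<mu>"
  shows "indep_var borel (\<lambda>e. e (Inr [])) borel (branch m \<phi>)"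
proof -
  define B :: "bool \<Rightarrow> (nat list + nat list) set" where
    "B b = (if b then {Inr []} else - {Inr []})" for b
  have ind: "indep_vars (\<lambda>j. PiM (B j) (\<lambda>_. borel)) (\<lambda>j e. restrict (\<lambda>i. e i) (B j)) UNIV"
    by (intro indep_vars_restrict[OF indep_coords]) (auto simp: disjoint_family_on_def B_def)
  define h :: "bool \<Rightarrow> env \<Rightarrow> real" where
    \<comment> \<open>The block without \<open>Inr []\<close> does not carry this coordinate; the
      value 0 is an arbitrary filler that \<open>branch\<close> does not read.\<close>
    "h b = (if b then (\<lambda>e. e (Inr [])) else (\<lambda>e. branch m \<phi> (e(Inr [] := 0))))" for b
  have h_meas: "h b \<in> borel_measurable (PiM (B b) (\<lambda>_. borel))" for b
  proof (cases b)
    case False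
    have "(\<lambda>e. (e(Inr [] := 0)) j) \<in> borel_measurable (PiM (B b) (\<lambda>_. borel))" for j
      by (cases "j = Inr []") (auto simp: B_def False intro!: measurable_component_singleton)
    then have "(\<lambda>e. e(Inr [] := 0)) \<in> PiM (B b) (\<lambda>_. borel) \<rightarrow>\<^sub>M PiM UNIV (\<lambda>_. borel)"
      by (intro measurable_PiM_single') (auto simp: space_PiM)
    then have "(\<lambda>e. e(Inr [] := 0)) \<in> PiM (B b) (\<lambda>_. borel) \<rightarrow>\<^sub>M \<mu>"
      by (simp cong: measurable_cong_sets add: sets_mu)
    then have "(\<lambda>e. branch m \<phi> (e(Inr [] := 0))) \<in> borel_measurable (PiM (B b) (\<lambda>_. borel))"
      by (rule measurable_compose) simp
    then show ?thesis by (simp add: h_def False)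
  qed (auto simp: h_def B_def intro!: measurable_component_singleton)
  have "indep_vars (\<lambda>_. borel) (\<lambda>b e. h b (restrict (\<lambda>i. e i) (B b))) UNIV"
    by (rule indep_vars_compose2[OF ind]) (use h_meas in auto)
  moreover have "h b (restrict (\<lambda>i. e i) (B b)) = (case_bool (\<lambda>e. e (Inr [])) (branch m \<phi>) b) e" for b e
  proof (cases b)
    case False
    have "subenv i ((restrict e (B b))(Inr [] := 0)) = subenv i e" for i
    proof
      fix j show "subenv i ((restrict e (B b))(Inr [] := 0)) j = subenv i e j"
        by (cases j) (auto simp: subenv_def B_def False)
    qed
    then show ?thesis by (simp add: h_def False branch_def kids_def B_def)
  qed (simp add: h_def B_def)
  ultimately have "indep_vars (\<lambda>_. borel) (case_bool (\<lambda>e. e (Inr [])) (branch m \<phi>)) UNIV"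
    by (simp add: fun_eq_iff)
  then show ?thesis unfolding indep_var_def
    by (rule indep_vars_cong[THEN iffD1, rotated -1]) (auto split: bool.split)
qed

end

section \<open>Moments of the conductance\<close>

lemma contraction_tendsto_0:
  fixes u b :: "nat \<Rightarrow> real"
  assumes u: "\<And>n. u n \<ge> 0" and r: "0 \<le> r" "r < 1"
    and step: "\<And>n. u (Suc n) \<le> r * u n + b n" and b: "b \<longlonglongrightarrow> 0"
  shows "u \<longlonglongrightarrow> 0"
proof (rule LIMSEQ_I)
  fix \<epsilon> :: real assume \<epsilon>: "\<epsilon> > 0"
  \<comment> \<open>With this threshold \<open>\<epsilon> / 2\<close> is the fixed point of the
    majorising step, so what remains decays like \<open>r ^ k\<close>.\<close>
  have "eventually (\<lambda>n. b n < (1 - r) * (\<epsilon> / 2)) sequentially"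
    using r \<epsilon> by (intro order_tendstoD(2)[OF b]) auto
  then obtain N where N: "\<And>n. n \<ge> N \<Longrightarrow> b n < (1 - r) * (\<epsilon> / 2)"
    by (auto simp: eventually_sequentially)
  have iter: "u (N + k) \<le> \<epsilon> / 2 + r ^ k * u N" for k
  proof (induction k)
    case (Suc k)
    have "u (N + Suc k) \<le> r * u (N + k) + (1 - r) * (\<epsilon> / 2)"
      using step[of "N + k"] N[of "N + k"] by simp
    also have "\<dots> \<le> r * (\<epsilon> / 2 + r ^ k * u N) + (1 - r) * (\<epsilon> / 2)"
      using Suc r by (intro add_right_mono mult_left_mono)
    also have "\<dots> = \<epsilon> / 2 + r ^ Suc k * u N" by (simp add: field_simps)
    finally show ?case .
  qed (use u \<epsilon> in auto)
  have "(\<lambda>k. r ^ k * u N) \<longlonglongrightarrow> 0 * u N"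
    using r by (intro tendsto_mult LIMSEQ_realpow_zero tendsto_const) auto
  then have "eventually (\<lambda>k. r ^ k * u N < \<epsilon> / 2) sequentially"
    using \<epsilon> by (intro order_tendstoD(2)) auto
  then obtain K where K: "\<And>k. k \<ge> K \<Longrightarrow> r ^ k * u N < \<epsilon> / 2"
    by (auto simp: eventually_sequentially)
  have "u n < \<epsilon>" if "n \<ge> N + K" for n
  proof -
    have "u n \<le> \<epsilon> / 2 + r ^ (n - N) * u N" using iter[of "n - N"] that by simp
    moreover have "r ^ (n - N) * u N < \<epsilon> / 2" using that by (intro K) auto
    ultimately show ?thesis by linarith
  qed
  then show "\<exists>n0. \<forall>n\<ge>n0. norm (u n - 0) < \<epsilon>" using u by auto
qed

text \<open>To be applied with means \<open>a\<close> and second moments \<open>q\<close>. Dividing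
  \<open>q_step\<close> by \<open>a (Suc n)\<close> shows that \<open>u = q / a\<close> contracts up
  to a vanishing error, hence tends to 0. By \<open>a_step\<close> the ratio
  \<open>a (Suc n) / a n\<close> then stays above a number larger than \<open>1 / m\<close>, and
  division by the square makes \<open>v = q / a ^ 2\<close> contract up to the constant
  \<open>k\<close>.\<close>

lemma square_moment_ratio_bounded:
  fixes a q :: "nat \<Rightarrow> real"
  assumes a: "\<And>n. a n > 0" "a \<longlonglongrightarrow> 0" and q: "\<And>n. q n \<ge> 0"
    and m: "m > 1" and k: "k \<ge> 0" and th: "\<theta> \<ge> 0"
    and q_step: "\<And>n. q (Suc n) \<le> q n / a n * a (Suc n) / m + k * a (Suc n) ^ 2"
    and a_step: "\<And>n. a n - a (Suc n) \<le> \<theta> * q n"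
  shows "\<exists>B>0. \<forall>n. q n \<le> B * a n ^ 2"
proof -
  define u where "u n = q n / a n" for n
  define v where "v n = q n / a n ^ 2" for n
  have u0: "u n \<ge> 0" and v0: "v n \<ge> 0" for n using a q by (auto simp: u_def v_def less_imp_le)
  have u_step: "u (Suc n) \<le> 1 / m * u n + k * a (Suc n)" for n
  proof -
    have "u (Suc n) \<le> (q n / a n * a (Suc n) / m + k * a (Suc n) ^ 2) / a (Suc n)"
      unfolding u_def using q_step[of n] a(1)[of "Suc n"] by (intro divide_right_mono) auto
    also have "\<dots> = 1 / m * u n + k * a (Suc n)"
      unfolding u_def using a(1)[of "Suc n"] a(1)[of n] m by (simp add: field_simps power2_eq_square)
    finally show ?thesis .
  qed
  have "(\<lambda>n. k * a (Suc n)) \<longlonglongrightarrow> k * 0"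
    by (intro tendsto_mult tendsto_const LIMSEQ_Suc a(2))
  then have "u \<longlonglongrightarrow> 0"
    by (intro contraction_tendsto_0[where r = "1 / m" and u = u, OF u0 _ _ u_step]) (use m in auto)
  then have "(\<lambda>n. \<theta> * u n) \<longlonglongrightarrow> \<theta> * 0" by (intro tendsto_mult tendsto_const)
  \<comment> \<open>The threshold is half of \<open>1 - 1 / m\<close>. It keeps
    \<open>a (Suc n) / a n\<close> at or above \<open>(m + 1) / (2 * m)\<close>, so the inverse
    ratio divided by \<open>m\<close> is at most \<open>2 / (m + 1)\<close>, the rate
    \<open>r\<close> below.\<close>
  then have "eventually (\<lambda>n. \<theta> * u n < (m - 1) / (2 * m)) sequentially"
    using m by (intro order_tendstoD(2)) auto
  then obtain N where N: "\<And>n. n \<ge> N \<Longrightarrow> \<theta> * u n < (m - 1) / (2 * m)"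
    by (auto simp: eventually_sequentially)
  define r where "r = 2 / (m + 1)"
  have r: "0 < r" "r < 1" using m by (auto simp: r_def)
  have v_step: "v (Suc n) \<le> r * v n + k" if "n \<ge> N" for n
  proof -
    have "a n * (1 - \<theta> * u n) = a n - \<theta> * q n"
      using a(1)[of n] by (simp add: u_def field_simps)
    then have "a (Suc n) \<ge> a n * (1 - \<theta> * u n)" using a_step[of n] by simp
    moreover have "a n * (1 - \<theta> * u n) \<ge> a n * (1 - (m - 1) / (2 * m))"
      using N[OF that] a(1)[of n] by (intro mult_left_mono) auto
    moreover have "1 - (m - 1) / (2 * m) = (m + 1) / (2 * m)" using m by (simp add: field_simps)
    ultimately have "a (Suc n) \<ge> a n * ((m + 1) / (2 * m))" by simp
    then have ge: "a n / m \<le> r * a (Suc n)" using m by (simp add: r_def field_simps)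
    have "v (Suc n) \<le> (q n / a n * a (Suc n) / m + k * a (Suc n) ^ 2) / a (Suc n) ^ 2"
      unfolding v_def using q_step[of n] by (intro divide_right_mono) auto
    also have "\<dots> = v n * (a n / m) / a (Suc n) + k"
      unfolding v_def using a(1)[of "Suc n"] a(1)[of n] m by (simp add: field_simps power2_eq_square)
    also have "\<dots> \<le> v n * (r * a (Suc n)) / a (Suc n) + k"
      using ge v0[of n] a(1)[of "Suc n"] by (intro add_right_mono divide_right_mono mult_left_mono) auto
    also have "\<dots> = r * v n + k" using a(1)[of "Suc n"] by simp
    finally show ?thesis .
  qed
  \<comment> \<open>This dominates \<open>v\<close> up to \<open>N\<close> and exceeds the fixed
    point \<open>k / (1 - r)\<close> of the step, so the bound propagates; the final 1 makes it
    strictly positive.\<close>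
  define B where "B = (\<Sum>n\<le>N. v n) + k / (1 - r) + 1"
  have sum0: "(\<Sum>n\<le>N. v n) \<ge> 0" using v0 by (intro sum_nonneg) auto
  have kr: "k / (1 - r) \<ge> 0" using r k by simp
  have B_inv: "r * B + k \<le> B"
  proof -
    have "k = (1 - r) * (k / (1 - r))" using r by simp
    also have "\<dots> \<le> (1 - r) * B" using r sum0 by (intro mult_left_mono) (auto simp: B_def)
    finally show ?thesis by (simp add: algebra_simps)
  qed
  have "v n \<le> B" for n
  proof (cases "n \<le> N")
    case True
    then have "v n \<le> (\<Sum>n\<le>N. v n)" using v0 by (intro member_le_sum) auto
    then show ?thesis using kr by (simp add: B_def)
  next
    case False
    have "v (N + j) \<le> B" for j
    proof (induction j)
      case 0
      have "v N \<le> (\<Sum>n\<le>N. v n)" using v0 by (intro member_le_sum) auto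
      then show ?case using kr by (simp add: B_def)
    next
      case (Suc j)
      have "v (N + Suc j) \<le> r * v (N + j) + k" using v_step[of "N + j"] by simp
      also have "\<dots> \<le> r * B + k" using Suc r by simp
      finally show ?case using B_inv by simp
    qed
    from this[of "n - N"] show ?thesis using False by simp
  qed
  then have "q n / a n ^ 2 \<le> B" for n by (simp add: v_def)
  then have "q n \<le> B * a n ^ 2" for n
    using a(1)[of n] pos_divide_le_eq[of "a n ^ 2" "q n" B] by (metis zero_less_power)
  moreover have "B > 0" using sum0 kr by (simp add: B_def)
  ultimately show ?thesis by blast
qed

section \<open>Means and second moments of the conductance in a random environment\<close>

declare cond.simps [simp del]

context galton_watson_env
begin

lemma good_pos:
  assumes "e \<in> good"
  shows "e (Inr x) > 0" "cond m n e > 0" "0 < through_edge (cond m n) e"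
    "through_edge (cond m n) e \<le> cond m n e" "through_edge (cond m n) e \<le> 1 / e (Inr [])"
proof -
  show x: "e (Inr x) > 0" for x using assms by (simp add: good_def)
  show c: "cond m n e > 0" using assms m_pos by (intro cond_pos) (auto simp: good_def)
  have d: "1 + e (Inr []) * cond m n e > 1" using x[of "[]"] c by simp
  then show "0 < through_edge (cond m n) e" using c by (simp add: through_edge_def)
  show "through_edge (cond m n) e \<le> cond m n e"
    unfolding through_edge_def using d c by (simp add: pos_divide_le_eq)
  show "through_edge (cond m n) e \<le> 1 / e (Inr [])"
  proof -
    have "1 + e (Inr []) * cond m n e > 0" using d by linarith
    then have "cond m n e / (1 + e (Inr []) * cond m n e) \<le> 1 / e (Inr []) \<longleftrightarrow>
        cond m n e * e (Inr []) \<le> 1 * (1 + e (Inr []) * cond m n e)"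
      using x[of "[]"] by (intro iffI) (auto simp: divide_simps mult.commute)
    then show ?thesis by (simp add: through_edge_def mult.commute)
  qed
qed

lemma good_decseq: "e \<in> good \<Longrightarrow> decseq (\<lambda>n. cond m n e)"
  using m_pos by (intro decseq_SucI cond_Suc_le) (auto simp: good_def)

lemma root_edge_integrable:
  "integrable \<mu> (\<lambda>e. e (Inr []))" "integrable \<mu> (\<lambda>e. 1 / e (Inr []))"
proof -
  show "integrable \<mu> (\<lambda>e. e (Inr []))"
    using eta_int by (subst (asm) distr_resistance[of "[]", symmetric]) (simp add: integrable_distr_eq)
  show "integrable \<mu> (\<lambda>e. 1 / e (Inr []))"
    using eta_inv_int by (subst (asm) distr_resistance[of "[]", symmetric]) (simp add: integrable_distr_eq)
qed

lemma cond_integrable: "integrable \<mu> (cond m n)"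
  and through_edge_integrable: "integrable \<mu> (through_edge (cond m n))"
proof -
  have *: "integrable \<mu> (through_edge (cond m n))" if "integrable \<mu> (cond m n)" for n
  proof (rule Bochner_Integration.integrable_bound[OF that])
    show "AE e in \<mu>. norm (through_edge (cond m n) e) \<le> norm (cond m n e)"
      using AE_good
    proof eventually_elim
      case (elim e)
      then show ?case using good_pos(2-5)[OF elim, of n] by simp
    qed
  qed simp
  show "integrable \<mu> (cond m n)"
  proof (induction n)
    case 0
    then show ?case using root_edge_integrable(2) by (simp add: branch_moment(1) cond.simps)
  next
    case (Suc n)
    then show ?case using *[OF Suc] by (simp add: branch_moment(1) cond.simps)
  qed
  then show "integrable \<mu> (through_edge (cond m n))" by (rule *)
qed

text \<open>Owing to the shift in \<open>cond\<close> this is E[C_(n+1)].\<close>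

definition mean_cond :: "nat \<Rightarrow> real" where
  "mean_cond n = expectation (cond m n)"

lemma mean_cond_Suc: "mean_cond (Suc n) = expectation (through_edge (cond m n))"
  using branch_moment(2)[OF _ through_edge_integrable] by (simp add: mean_cond_def cond.simps)

lemma expectation_pos:
  assumes "integrable \<mu> f" "AE e in \<mu>. f e > 0"
  shows "expectation f > (0::real)"
proof -
  have "expectation f \<ge> 0" using assms(2) by (intro integral_nonneg_AE) auto
  moreover have "expectation f \<noteq> 0"
  proof
    assume "expectation f = 0"
    then have "AE e in \<mu>. f e = 0"
      using assms by (subst (asm) integral_nonneg_eq_0_iff_AE) auto
    then have "AE e in \<mu>. False" using assms(2) by eventually_elim auto
    then show False by simp
  qed
  ultimately show ?thesis by simp
qed

lemma mean_cond_pos: "mean_cond n > 0"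
  unfolding mean_cond_def
  using AE_good by (intro expectation_pos cond_integrable) (auto elim!: eventually_mono intro: good_pos)

lemma mean_cond_decseq: "decseq mean_cond"
proof (rule decseq_SucI)
  fix n
  show "mean_cond (Suc n) \<le> mean_cond n"
    unfolding mean_cond_Suc unfolding mean_cond_def
    using AE_good by (intro integral_mono_AE cond_integrable through_edge_integrable)
      (auto elim!: eventually_mono intro: good_pos)
qed

lemma root_edge_indep_cond:
  fixes h1 h2 :: "real \<Rightarrow> real"
  assumes [measurable]: "h1 \<in> borel_measurable borel" "h2 \<in> borel_measurable borel"
    and int: "integrable \<mu> (\<lambda>e. h1 (e (Inr [])))" "integrable \<mu> (\<lambda>e. h2 (cond m n e))"
  shows "integrable \<mu> (\<lambda>e. h1 (e (Inr [])) * h2 (cond m n e))"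
    "expectation (\<lambda>e. h1 (e (Inr [])) * h2 (cond m n e)) =
      expectation (\<lambda>e. h1 (e (Inr []))) * expectation (\<lambda>e. h2 (cond m n e))"
proof -
  have "indep_var borel (\<lambda>e. e (Inr [])) borel (cond m n)"
    by (cases n) (auto simp: cond.simps intro!: indep_root_edge_branch)
  from indep_var_compose[OF this, of h1 borel h2 borel]
  have *: "indep_var borel (\<lambda>e. h1 (e (Inr []))) borel (\<lambda>e. h2 (cond m n e))"
    by (simp add: o_def)
  show "integrable \<mu> (\<lambda>e. h1 (e (Inr [])) * h2 (cond m n e))"
    by (rule indep_var_integrable[OF * int])
  show "expectation (\<lambda>e. h1 (e (Inr [])) * h2 (cond m n e)) =
      expectation (\<lambda>e. h1 (e (Inr []))) * expectation (\<lambda>e. h2 (cond m n e))"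
    by (rule indep_var_lebesgue_integral[OF * int])
qed

text \<open>One factor is bounded by the conductance and the other by \<open>1 / e (Inr [])\<close>;
  the product of these independent bounds is integrable. Thus integrability of 1 / xi suffices, even
  where \<open>cond m n\<close> itself has no second moment.\<close>

lemma through_edge_square_integrable: "integrable \<mu> (\<lambda>e. through_edge (cond m n) e ^ 2)"
proof (rule Bochner_Integration.integrable_bound)
  show "integrable \<mu> (\<lambda>e. 1 / e (Inr []) * cond m n e)"
    by (rule root_edge_indep_cond(1)[of "\<lambda>r. 1 / r" "\<lambda>c. c"])
      (auto intro: root_edge_integrable cond_integrable)
  show "AE e in \<mu>. norm (through_edge (cond m n) e ^ 2) \<le> norm (1 / e (Inr []) * cond m n e)"
    using AE_good
  proof eventually_elim
    case (elim e)
    note g = good_pos(1)[OF elim, of "[]"] good_pos(2-5)[OF elim, of n]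
    have "through_edge (cond m n) e * through_edge (cond m n) e \<le> 1 / e (Inr []) * cond m n e"
      using g by (intro mult_mono) (auto simp: less_imp_le)
    moreover have "0 \<le> 1 / e (Inr []) * cond m n e" using g by (simp add: less_imp_le)
    ultimately show ?case using g by (simp add: power2_eq_square)
  qed
qed simp

lemma cond_Suc_square:
  "integrable \<mu> (\<lambda>e. cond m (Suc n) e ^ 2)"
  "expectation (\<lambda>e. cond m (Suc n) e ^ 2) =
    expectation (\<lambda>e. through_edge (cond m n) e ^ 2) / m + \<kappa> * mean_cond (Suc n) ^ 2"
  using branch_square[OF _ through_edge_square_integrable] by (simp_all add: mean_cond_Suc cond.simps)

definition mean_res :: real where
  "mean_res = expectation (\<lambda>e. e (Inr []))"

lemma mean_res_pos: "mean_res > 0"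
  unfolding mean_res_def
  using AE_good by (intro expectation_pos root_edge_integrable) (auto elim!: eventually_mono intro: good_pos)

text \<open>The loss c - c / (1 + r c) equals r c^2 / (1 + r c) and is at most r c^2, whose mean
  factors by independence of the root edge.\<close>

lemma mean_cond_diff_le:
  assumes sq: "integrable \<mu> (\<lambda>e. cond m n e ^ 2)"
  shows "mean_cond n - mean_cond (Suc n) \<le> mean_res * expectation (\<lambda>e. cond m n e ^ 2)"
proof -
  have "mean_cond n - mean_cond (Suc n) = expectation (\<lambda>e. cond m n e - through_edge (cond m n) e)"
    unfolding mean_cond_Suc unfolding mean_cond_def
    by (rule Bochner_Integration.integral_diff[symmetric]) (rule cond_integrable through_edge_integrable)+
  also have "\<dots> \<le> expectation (\<lambda>e. e (Inr []) * cond m n e ^ 2)"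
  proof (rule integral_mono_AE)
    show "integrable \<mu> (\<lambda>e. cond m n e - through_edge (cond m n) e)"
      by (intro Bochner_Integration.integrable_diff cond_integrable through_edge_integrable)
    show "integrable \<mu> (\<lambda>e. e (Inr []) * cond m n e ^ 2)"
      using root_edge_indep_cond(1)[of "\<lambda>r. r" "\<lambda>c. c ^ 2" n] root_edge_integrable sq by simp
    show "AE e in \<mu>. cond m n e - through_edge (cond m n) e \<le> e (Inr []) * cond m n e ^ 2"
      using AE_good
    proof eventually_elim
      case (elim e)
      define c r where "c = cond m n e" and "r = e (Inr [])"
      have cr: "c > 0" "r > 0" using good_pos[OF elim] by (auto simp: c_def r_def)
      then have d: "1 + r * c > 1" by simp
      have "c - c / (1 + r * c) = r * c ^ 2 / (1 + r * c)"
        using d by (simp add: field_simps power2_eq_square)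
      also have "\<dots> \<le> r * c ^ 2 / 1"
        using d cr by (intro divide_left_mono) (auto intro!: add_pos_pos)
      finally show ?case by (simp add: c_def r_def through_edge_def)
    qed
  qed
  also have "\<dots> = mean_res * expectation (\<lambda>e. cond m n e ^ 2)"
    unfolding mean_res_def
    using root_edge_indep_cond(2)[of "\<lambda>r. r" "\<lambda>c. c ^ 2" n] root_edge_integrable sq by simp
  finally show ?thesis .
qed

text \<open>With \<open>t = E[c^2] / E[c]\<close>, the factors \<open>c - t\<close> and \<open>1 / (1 + r c) - 1 / (1 + r t)\<close> have opposite
  signs, and \<open>c (c - t) / (1 + r t)\<close> has mean zero because the root edge is independent of \<open>c\<close>.\<close>

lemma through_edge_square_le:
  assumes sq: "integrable \<mu> (\<lambda>e. cond m n e ^ 2)"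
  shows "expectation (\<lambda>e. through_edge (cond m n) e ^ 2) \<le>
    expectation (\<lambda>e. cond m n e ^ 2) / mean_cond n * mean_cond (Suc n)"
proof -
  define t where "t = expectation (\<lambda>e. cond m n e ^ 2) / mean_cond n"
  have t: "t \<ge> 0" unfolding t_def using mean_cond_pos[of n] by (intro divide_nonneg_pos integral_nonneg_AE) auto
  have i1: "integrable \<mu> (\<lambda>e. cond m n e ^ 2 - t * cond m n e)"
    using sq cond_integrable by (intro Bochner_Integration.integrable_diff integrable_mult_right) auto
  have i2: "integrable \<mu> (\<lambda>e. 1 / (1 + e (Inr []) * t))"
  proof (rule integrable_const_bound[of _ 1])
    show "AE e in \<mu>. norm (1 / (1 + e (Inr []) * t)) \<le> 1"
      using AE_good
    proof eventually_elim
      case (elim e)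
      have "e (Inr []) * t \<ge> 0" using good_pos(1)[OF elim] t by (simp add: less_imp_le)
      then show ?case by (simp add: divide_le_eq)
    qed
  qed simp
  note ind = root_edge_indep_cond[where ?h1.0 = "\<lambda>r. 1 / (1 + r * t)" and ?h2.0 = "\<lambda>c. c ^ 2 - t * c", OF _ _ i2 i1]
  have zero: "expectation (\<lambda>e. 1 / (1 + e (Inr []) * t) * (cond m n e ^ 2 - t * cond m n e)) = 0"
  proof -
    have "expectation (\<lambda>e. cond m n e ^ 2 - t * cond m n e) = expectation (\<lambda>e. cond m n e ^ 2) - t * mean_cond n"
      unfolding mean_cond_def
      by (subst Bochner_Integration.integral_diff) (use sq cond_integrable in auto)
    also have "\<dots> = 0" using mean_cond_pos[of n] by (simp add: t_def)
    finally show ?thesis using ind(2) by simp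
  qed
  have i3: "integrable \<mu> (\<lambda>e. 1 / (1 + e (Inr []) * t) * (cond m n e ^ 2 - t * cond m n e))"
    using ind(1) by simp
  have i4: "integrable \<mu> (\<lambda>e. t * through_edge (cond m n) e)"
    by (intro integrable_mult_right through_edge_integrable)
  have "expectation (\<lambda>e. through_edge (cond m n) e ^ 2) \<le>
      expectation (\<lambda>e. t * through_edge (cond m n) e +
        1 / (1 + e (Inr []) * t) * (cond m n e ^ 2 - t * cond m n e))"
  proof (rule integral_mono_AE)
    show "AE e in \<mu>. through_edge (cond m n) e ^ 2 \<le> t * through_edge (cond m n) e +
        1 / (1 + e (Inr []) * t) * (cond m n e ^ 2 - t * cond m n e)"
      using AE_good
    proof eventually_elim
      case (elim e)
      define c r where "c = cond m n e" and "r = e (Inr [])"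
      have cr: "c > 0" "r > 0" using good_pos[OF elim] by (auto simp: c_def r_def)
      then have d: "1 + r * c > 1" by simp
      have dt: "1 + r * t \<ge> 1" using cr t by simp
      have "(c / (1 + r * c)) ^ 2 \<le> c ^ 2 / (1 + r * c)"
      proof -
        have "(c / (1 + r * c)) ^ 2 = c ^ 2 / (1 + r * c) / (1 + r * c)"
          by (simp add: power2_eq_square)
        also have "\<dots> \<le> c ^ 2 / (1 + r * c) / 1"
          using d cr by (intro divide_left_mono) (auto intro!: add_pos_pos)
        finally show ?thesis by simp
      qed
      also have "c ^ 2 / (1 + r * c) \<le> t * (c / (1 + r * c)) + 1 / (1 + r * t) * (c ^ 2 - t * c)"
      proof -
        have "t * (c / (1 + r * c)) + 1 / (1 + r * t) * (c ^ 2 - t * c) - c ^ 2 / (1 + r * c)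
            = c * r * (c - t) ^ 2 / ((1 + r * c) * (1 + r * t))"
          using d dt by (simp add: divide_simps) (simp add: algebra_simps power2_eq_square)
        also have "\<dots> \<ge> 0" using d dt cr by simp
        finally show ?thesis by simp
      qed
      finally show ?case by (simp only: c_def r_def through_edge_def)
    qed
  qed (use i3 i4 through_edge_square_integrable in auto)
  also have "\<dots> = t * mean_cond (Suc n)"
    unfolding mean_cond_Suc using zero by (subst Bochner_Integration.integral_add[OF i4 i3]) simp
  finally show ?thesis by (simp add: t_def)
qed

text \<open>A soft argument by dominated convergence, without a rate: the second moment bound, on
  which the rate rests, takes this limit as input.\<close>

lemma mean_cond_tendsto_0: "mean_cond \<longlonglongrightarrow> 0"
proof -
  define L where "L e = lim (\<lambda>n. cond m n e)" for e
  have [measurable]: "L \<in> borel_measurable \<mu>" unfolding L_def[abs_def] by measurable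
  have L: "(\<lambda>n. cond m n e) \<longlonglongrightarrow> L e" "L e \<ge> 0" if e: "e \<in> good" for e
  proof -
    have "cond m n e \<ge> 0" for n using good_pos(2)[OF e] by (rule less_imp_le)
    then obtain l where "(\<lambda>n. cond m n e) \<longlonglongrightarrow> l"
      using decseq_convergent[OF good_decseq[OF e], of 0] by blast
    then show lim: "(\<lambda>n. cond m n e) \<longlonglongrightarrow> L e" unfolding L_def by (simp add: limI)
    show "L e \<ge> 0" by (rule LIMSEQ_le_const[OF lim]) (auto simp: less_imp_le good_pos(2)[OF e])
  qed
  have le0: "cond m n e \<le> cond m 0 e" if "e \<in> good" for n e
    using good_decseq[OF that] by (auto simp: decseq_def)
  have lim1: "mean_cond \<longlonglongrightarrow> expectation L"
    unfolding mean_cond_def[abs_def]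
  proof (rule integral_dominated_convergence[where w = "cond m 0"])
    show "AE e in \<mu>. (\<lambda>n. cond m n e) \<longlonglongrightarrow> L e" using AE_good by eventually_elim (rule L)
    show "AE e in \<mu>. norm (cond m n e) \<le> cond m 0 e" for n
      using AE_good by eventually_elim (use le0 good_pos(2) in \<open>auto simp: less_imp_le\<close>)
  qed (use cond_integrable in auto)
  \<comment> \<open>The expected decrement tends to 0, so the limit is not reduced by one more edge and must vanish.\<close>
  define D where "D e = L e - L e / (1 + e (Inr []) * L e)" for e
  have [measurable]: "D \<in> borel_measurable \<mu>" unfolding D_def[abs_def] by measurable
  have "(\<lambda>n. mean_cond n - mean_cond (Suc n)) \<longlonglongrightarrow> expectation D \<and> integrable \<mu> D"
  proof -
    have conv: "AE e in \<mu>. (\<lambda>n. cond m n e - through_edge (cond m n) e) \<longlonglongrightarrow> D e"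
      using AE_good
    proof eventually_elim
      case (elim e)
      have "1 + e (Inr []) * L e \<noteq> 0"
        using good_pos(1)[OF elim, of "[]"] L(2)[OF elim] by (smt (verit) mult_nonneg_nonneg)
      then show ?case unfolding D_def through_edge_def by (intro tendsto_intros L elim)
    qed
    have bound: "AE e in \<mu>. norm (cond m n e - through_edge (cond m n) e) \<le> cond m 0 e" for n
      using AE_good
    proof eventually_elim
      case (elim e)
      then show ?case using le0[OF elim, of n] good_pos(3,4)[OF elim, of n] by simp
    qed
    have "mean_cond n - mean_cond (Suc n) = expectation (\<lambda>e. cond m n e - through_edge (cond m n) e)" for n
      unfolding mean_cond_Suc unfolding mean_cond_def
      by (rule Bochner_Integration.integral_diff[symmetric]) (rule cond_integrable through_edge_integrable)+
    moreover have "(\<lambda>n. expectation (\<lambda>e. cond m n e - through_edge (cond m n) e)) \<longlonglongrightarrow> expectation D"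
      by (rule integral_dominated_convergence[OF _ _ cond_integrable conv bound]) simp_all
    moreover have "integrable \<mu> D"
      by (rule integrable_dominated_convergence[OF _ _ cond_integrable conv bound]) simp_all
    ultimately show ?thesis by simp
  qed
  moreover have "(\<lambda>n. mean_cond n - mean_cond (Suc n)) \<longlonglongrightarrow> expectation L - expectation L"
    by (intro tendsto_diff lim1 LIMSEQ_Suc)
  ultimately have D0: "expectation D = 0" "integrable \<mu> D" using LIMSEQ_unique by fastforce+
  have D_eq: "D e = e (Inr []) * L e ^ 2 / (1 + e (Inr []) * L e)" if "e \<in> good" for e
  proof -
    have "e (Inr []) * L e \<ge> 0" using good_pos(1)[OF that, of "[]"] L(2)[OF that] by simp
    then have "1 + e (Inr []) * L e > 0" by linarith
    then show ?thesis by (simp add: D_def field_simps power2_eq_square)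
  qed
  have D_nonneg: "D e \<ge> 0" if "e \<in> good" for e
    unfolding D_eq[OF that] using good_pos(1)[OF that, of "[]"] L(2)[OF that] by simp
  have "AE e in \<mu>. D e = 0"
    using D0 AE_good by (subst (asm) integral_nonneg_eq_0_iff_AE) (auto elim!: eventually_mono intro: D_nonneg)
  then have "AE e in \<mu>. L e = 0" using AE_good
  proof eventually_elim
    case (elim e)
    then have "e (Inr []) * L e ^ 2 / (1 + e (Inr []) * L e) = 0" by (simp add: D_eq)
    moreover have "1 + e (Inr []) * L e \<noteq> 0"
      using good_pos(1)[OF elim(2), of "[]"] L(2)[OF elim(2)] by (smt (verit) mult_nonneg_nonneg)
    ultimately show ?case using good_pos(1)[OF elim(2), of "[]"] by simp
  qed
  then have "expectation L = 0" by (rule integral_eq_zero_AE)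
  then show ?thesis using lim1 by simp
qed

lemma kappa_nonneg: "\<kappa> \<ge> 0"
proof -
  have "m \<le> measure_pmf.expectation p (\<lambda>k. real k ^ 2)"
    unfolding m_def
  proof (rule integral_mono[OF integrable_p p_square])
    fix k :: nat
    show "real k \<le> real k ^ 2" by (cases k) (auto simp: power2_eq_square)
  qed
  then show ?thesis by (simp add: \<kappa>_def)
qed

text \<open>The index starts at 1 because \<open>cond m 0\<close> is a sum of inverse resistances
  and is square integrable only if 1 / xi is.\<close>

lemma cond_square_le:
  "\<exists>B>0. \<forall>n\<ge>1. expectation (\<lambda>e. cond m n e ^ 2) \<le> B * mean_cond n ^ 2"
proof -
  have "\<exists>B>0. \<forall>n. expectation (\<lambda>e. cond m (Suc n) e ^ 2) \<le> B * mean_cond (Suc n) ^ 2"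
  proof (rule square_moment_ratio_bounded[where m = m and k = \<kappa> and \<theta> = mean_res])
    show "(\<lambda>n. mean_cond (Suc n)) \<longlonglongrightarrow> 0" by (rule LIMSEQ_Suc[OF mean_cond_tendsto_0])
    fix n
    show "expectation (\<lambda>e. cond m (Suc (Suc n)) e ^ 2) \<le>
        expectation (\<lambda>e. cond m (Suc n) e ^ 2) / mean_cond (Suc n) * mean_cond (Suc (Suc n)) / m +
        \<kappa> * mean_cond (Suc (Suc n)) ^ 2"
      unfolding cond_Suc_square(2)[of "Suc n"]
      using through_edge_square_le[OF cond_Suc_square(1)] m_pos
      by (intro add_right_mono divide_right_mono) auto
  qed (use mean_cond_pos m_gt1 kappa_nonneg mean_res_pos mean_cond_diff_le[OF cond_Suc_square(1)]
      in \<open>auto\<close>)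
  then show ?thesis by (metis One_nat_def Suc_le_D)
qed

end

section \<open>Almost sure convergence\<close>

text \<open>With \<open>J n\<close> the last \<open>j\<close> such that \<open>N j \<le> n\<close>,
  monotonicity traps \<open>x n / a n\<close> between \<open>lo (J n)\<close> and
  \<open>hi (J n)\<close>, quotients of neighbouring subsequence terms. The change of index costs a
  factor \<open>\<delta> (Suc j) / \<delta> j\<close>, which tends to 1. The condition
  \<open>j \<le> N j\<close> makes the maximum one over a finite set.\<close>

lemma tendsto_along_dense_subsequence:
  fixes x a \<delta> :: "nat \<Rightarrow> real" and N :: "nat \<Rightarrow> nat"
  assumes x: "decseq x" "\<And>n. x n \<ge> 0" and a: "decseq a" "\<And>n. a n > 0"
    and N: "mono N" "\<And>j. j \<le> N j" and \<delta>: "\<And>j. \<delta> j > 0"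
    and xN: "(\<lambda>j. x (N j) / \<delta> j) \<longlonglongrightarrow> w" and aN: "(\<lambda>j. a (N j) / \<delta> j) \<longlonglongrightarrow> 1"
    and ratio: "(\<lambda>j. \<delta> (Suc j) / \<delta> j) \<longlonglongrightarrow> 1"
  shows "(\<lambda>n. x n / a n) \<longlonglongrightarrow> w"
proof -
  define J where "J n = Max {j. N j \<le> n}" for n
  have fin: "finite {j. N j \<le> n}" for n
    by (rule finite_subset[of _ "{..n}"]) (auto intro: order_trans[OF N(2)])
  have J: "N (J n) \<le> n" "n < N (Suc (J n))" if "N 0 \<le> n" for n
  proof -
    have "J n \<in> {j. N j \<le> n}" unfolding J_def using that fin by (intro Max_in) auto
    then show "N (J n) \<le> n" by simp
    show "n < N (Suc (J n))"
    proof (rule ccontr)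
      assume "\<not> n < N (Suc (J n))"
      then have "Suc (J n) \<le> J n" unfolding J_def using fin by (intro Max_ge) auto
      then show False by simp
    qed
  qed
  have J_lim: "filterlim J sequentially sequentially"
    unfolding filterlim_at_top
  proof
    fix K
    show "eventually (\<lambda>n. K \<le> J n) sequentially"
      unfolding J_def by (rule eventually_sequentiallyI[of "N K"]) (use fin in \<open>auto intro: Max_ge\<close>)
  qed
  define lo where "lo j = x (N (Suc j)) / \<delta> (Suc j) * (\<delta> (Suc j) / \<delta> j) / (a (N j) / \<delta> j)" for j
  define hi where "hi j = x (N j) / \<delta> j / (a (N (Suc j)) / \<delta> (Suc j) * (\<delta> (Suc j) / \<delta> j))" for j
  have "lo \<longlonglongrightarrow> w * 1 / 1" unfolding lo_def
    by (intro tendsto_intros LIMSEQ_Suc[OF xN] ratio aN) simp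
  moreover have "hi \<longlonglongrightarrow> w / (1 * 1)" unfolding hi_def
    by (intro tendsto_intros xN ratio LIMSEQ_Suc[OF aN]) simp
  ultimately have lims: "(\<lambda>n. lo (J n)) \<longlonglongrightarrow> w" "(\<lambda>n. hi (J n)) \<longlonglongrightarrow> w"
    using filterlim_compose[OF _ J_lim] by auto
  have lo_eq: "lo j = x (N (Suc j)) / a (N j)" for j
    using \<delta>[of j] \<delta>[of "Suc j"] by (simp add: lo_def)
  have hi_eq: "hi j = x (N j) / a (N (Suc j))" for j
    using \<delta>[of j] \<delta>[of "Suc j"] by (simp add: hi_def)
  show ?thesis
  proof (rule tendsto_sandwich[OF _ _ lims])
    show "eventually (\<lambda>n. lo (J n) \<le> x n / a n) sequentially"
    proof (rule eventually_sequentiallyI[of "N 0"])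
      fix n assume "N 0 \<le> n"
      then have "x (N (Suc (J n))) \<le> x n" "a n \<le> a (N (J n))"
        using J[of n] x(1) a(1) by (auto simp: decseq_def)
      then show "lo (J n) \<le> x n / a n" unfolding lo_eq using x(2) a(2) by (intro frac_le) auto
    qed
    show "eventually (\<lambda>n. x n / a n \<le> hi (J n)) sequentially"
    proof (rule eventually_sequentiallyI[of "N 0"])
      fix n assume "N 0 \<le> n"
      then have "x n \<le> x (N (J n))" "a (N (Suc (J n))) \<le> a n"
        using J[of n] x(1) a(1) by (auto simp: decseq_def)
      then show "x n / a n \<le> hi (J n)" unfolding hi_eq using x(2) a(2) by (intro frac_le) auto
    qed
  qed
qed

lemma AE_summable_of_summable_integrals:
  fixes f :: "nat \<Rightarrow> 'a \<Rightarrow> real"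
  assumes f: "\<And>j. integrable M (f j)" "\<And>j. AE x in M. f j x \<ge> 0"
    and sum: "summable (\<lambda>j. integral\<^sup>L M (f j))"
  shows "AE x in M. summable (\<lambda>j. f j x)"
proof -
  have [measurable]: "f j \<in> borel_measurable M" for j using f(1) by auto
  have "(\<integral>\<^sup>+x. (\<Sum>j. ennreal (f j x)) \<partial>M) = (\<Sum>j. \<integral>\<^sup>+x. ennreal (f j x) \<partial>M)"
    by (rule nn_integral_suminf) simp
  also have "\<dots> = (\<Sum>j. ennreal (integral\<^sup>L M (f j)))"
    by (intro suminf_cong nn_integral_eq_integral f)
  also have "\<dots> = ennreal (\<Sum>j. integral\<^sup>L M (f j))"
    by (rule suminf_ennreal2) (auto intro!: integral_nonneg_AE f sum)
  finally have "(\<integral>\<^sup>+x. (\<Sum>j. ennreal (f j x)) \<partial>M) \<noteq> \<infinity>" by simp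
  then have "AE x in M. (\<Sum>j. ennreal (f j x)) \<noteq> \<infinity>"
    by (intro nn_integral_PInf_AE) simp
  moreover have "AE x in M. \<forall>j. f j x \<ge> 0" using f(2) by (simp add: AE_all_countable)
  ultimately show ?thesis
    by eventually_elim (auto intro: summable_suminf_not_top)
qed

text \<open>Take the first index at which \<open>a\<close> has dropped to \<open>\<delta> j\<close>.
  One index earlier \<open>a\<close> was still above \<open>\<delta> j\<close>, and a single step
  loses at most the fraction \<open>D * a n\<close>, so the drop cannot overshoot by much.\<close>

lemma exists_dense_subsequence:
  fixes a :: "nat \<Rightarrow> real"
  assumes a: "decseq a" "\<And>n. a n > 0" "a \<longlonglongrightarrow> 0"
    and D: "D \<ge> 0" and step: "\<And>n. n \<ge> 1 \<Longrightarrow> a n - a (Suc n) \<le> D * a n ^ 2"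
    and \<delta>: "decseq \<delta>" "\<And>j. \<delta> j > 0" "\<delta> \<longlonglongrightarrow> 0"
  obtains N :: "nat \<Rightarrow> nat" where "mono N" "\<And>j. N j \<ge> 1" "\<And>j. a (N j) \<le> \<delta> j"
    "(\<lambda>j. a (N j) / \<delta> j) \<longlonglongrightarrow> 1"
proof -
  define N where "N j = (LEAST n. n \<ge> 1 \<and> a n \<le> \<delta> j)" for j
  have ex: "\<exists>n. n \<ge> 1 \<and> a n \<le> \<delta> j" for j
  proof -
    have "eventually (\<lambda>n. a n < \<delta> j) sequentially" by (rule order_tendstoD(2)[OF a(3) \<delta>(2)])
    then obtain n where "\<And>k. k \<ge> n \<Longrightarrow> a k < \<delta> j" by (auto simp: eventually_sequentially)
    from this[of "max n 1"] show ?thesis by (intro exI[of _ "max n 1"]) auto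
  qed
  have N: "N j \<ge> 1 \<and> a (N j) \<le> \<delta> j" for j unfolding N_def by (rule LeastI_ex[OF ex])
  have least: "N j \<le> n" if "n \<ge> 1" "a n \<le> \<delta> j" for n j
    unfolding N_def using that by (intro Least_le) auto
  have "mono N"
  proof (rule monoI)
    fix i j :: nat assume "i \<le> j"
    then have "\<delta> j \<le> \<delta> i" using \<delta>(1) by (auto simp: decseq_def)
    then show "N i \<le> N j" using N[of j] by (intro least) auto
  qed
  have N_lim: "filterlim N sequentially sequentially"
    unfolding filterlim_at_top
  proof
    fix K
    have "eventually (\<lambda>j. \<delta> j < a K) sequentially" by (rule order_tendstoD(2)[OF \<delta>(3) a(2)])
    then show "eventually (\<lambda>j. K \<le> N j) sequentially"
    proof eventually_elim
      case (elim j)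
      show "K \<le> N j"
      proof (rule ccontr)
        assume "\<not> K \<le> N j"
        then have "a K \<le> a (N j)" using a(1) by (auto simp: decseq_def)
        then show False using N[of j] elim by simp
      qed
    qed
  qed
  have pred_lim: "filterlim (\<lambda>j. N j - 1) sequentially sequentially"
    using filterlim_compose[OF filterlim_minus_const_nat_at_top N_lim] by (simp add: o_def)
  have "(\<lambda>j. a (N j) / \<delta> j) \<longlonglongrightarrow> 1"
  proof (rule tendsto_sandwich[where f = "\<lambda>j. 1 - D * a (N j - 1)" and h = "\<lambda>_. 1"])
    show "(\<lambda>_. 1) \<longlonglongrightarrow> (1::real)" by simp
    have "(\<lambda>j. a (N j - 1)) \<longlonglongrightarrow> 0" by (rule filterlim_compose[OF a(3) pred_lim])
    then have *: "(\<lambda>j. 1 - D * a (N j - 1)) \<longlonglongrightarrow> 1 - D * 0" by (intro tendsto_intros)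
    then show "(\<lambda>j. 1 - D * a (N j - 1)) \<longlonglongrightarrow> 1" by simp
    have "eventually (\<lambda>j. 1 - D * a (N j - 1) > 0) sequentially"
      using * by (intro order_tendstoD(1)) auto
    \<comment> \<open>The predecessor of \<open>N j\<close> must be at least 1, since both the
      minimality of \<open>N j\<close> and the bound \<open>step\<close> are restricted to such
      indices.\<close>
    moreover have "eventually (\<lambda>j. 2 \<le> N j) sequentially"
      using N_lim by (auto simp: filterlim_at_top)
    ultimately show "eventually (\<lambda>j. 1 - D * a (N j - 1) \<le> a (N j) / \<delta> j) sequentially"
    proof eventually_elim
      case (elim j)
      define n where "n = N j - 1"
      have n: "n \<ge> 1" "N j = Suc n" using elim by (auto simp: n_def)
      have "\<delta> j < a n" using least[of n j] n by (cases "a n \<le> \<delta> j") auto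
      then have "\<delta> j * (1 - D * a n) \<le> a n * (1 - D * a n)"
        using elim by (intro mult_right_mono) (auto simp: n_def)
      also have "\<dots> \<le> a (Suc n)" using step[OF n(1)] by (simp add: power2_eq_square algebra_simps)
      finally show ?case unfolding n using \<delta>(2)[of j] by (simp add: pos_le_divide_eq mult.commute)
    qed
    show "eventually (\<lambda>j. a (N j) / \<delta> j \<le> 1) sequentially"
      using N \<delta>(2) by (intro always_eventually allI) (simp add: divide_le_eq_1_pos)
  qed
  with \<open>mono N\<close> N show thesis by (intro that) auto
qed

section \<open>Convergence on the canonical space\<close>

context galton_watson_env
begin

lemma prob_UNIV [simp]: "prob UNIV = 1"
  using prob_space by simp

lemma branch_mono_good:
  assumes "\<And>e. e \<in> good \<Longrightarrow> f e \<le> g e" and "e \<in> good"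
  shows "branch m f e \<le> branch m g e"
  unfolding branch_def using assms good_subenv m_pos by (intro divide_right_mono sum_mono) auto

text \<open>Rayleigh monotonicity: the right side is the conductance after the resistances of the
  first \<open>k\<close> generations are set to 0.\<close>

lemma cond_add_le: "e \<in> good \<Longrightarrow> cond m (n + k) e \<le> (branch m ^^ k) (cond m n) e"
proof (induction k arbitrary: e)
  case (Suc k)
  have "cond m (n + Suc k) e = branch m (through_edge (cond m (n + k))) e" by (simp add: cond.simps)
  also have "\<dots> \<le> branch m (cond m (n + k)) e"
    using Suc.prems by (intro branch_mono_good) (auto intro: good_pos)
  also have "\<dots> \<le> branch m ((branch m ^^ k) (cond m n)) e"
    using Suc by (intro branch_mono_good) auto
  finally show ?case by simp
qed simp

lemma branch_pow_diff:
  "(branch m ^^ k) (\<lambda>e. f e - g e) e = (branch m ^^ k) f e - (branch m ^^ k) g e"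
proof (induction k arbitrary: e)
  case (Suc k)
  have "(branch m ^^ k) (\<lambda>e. f e - g e) = (\<lambda>e. (branch m ^^ k) f e - (branch m ^^ k) g e)"
    using Suc by (rule ext)
  then show ?case by (simp add: branch_diff)
qed simp

lemma branch_divide: "branch m (\<lambda>e. f e / c) e = branch m f e / c"
  by (simp add: branch_def sum_divide_distrib[symmetric] mult.commute)

lemma branch_pow_divide: "(branch m ^^ k) (\<lambda>e. f e / c) e = (branch m ^^ k) f e / c"
proof (induction k arbitrary: e)
  case (Suc k)
  have "(branch m ^^ k) (\<lambda>e. f e / c) = (\<lambda>e. (branch m ^^ k) f e / c)"
    using Suc by (rule ext)
  then show ?case by (simp add: branch_divide)
qed simp

text \<open>The increments are the iterates of \<open>branch\<close> on the centred function
  \<open>d\<close>, so their second moments decay like \<open>1 / m ^ k\<close>. This gives absolute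
  summability directly, and with it the existence of the limit that \<open>lim\<close>
  presupposes.\<close>

lemma AE_martingale_convergent: "AE e in \<mu>. convergent (\<lambda>k. (branch m ^^ k) (\<lambda>_. 1) e)"
proof -
  define d where "d e = branch m (\<lambda>_. 1) e - 1" for e
  have [measurable]: "d \<in> borel_measurable \<mu>" unfolding d_def[abs_def] by measurable
  have one: "integrable \<mu> (branch m (\<lambda>_. 1))" "expectation (branch m (\<lambda>_. 1)) = 1"
    using branch_moment[of "\<lambda>_. 1"] by simp_all
  have d2: "integrable \<mu> (\<lambda>e. d e ^ 2)"
  proof -
    have "integrable \<mu> (\<lambda>e. branch m (\<lambda>_. 1) e ^ 2 - 2 * branch m (\<lambda>_. 1) e + 1)"
      using branch_square(1)[of "\<lambda>_. 1"] one by auto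
    then show ?thesis by (simp add: d_def power2_diff algebra_simps)
  qed
  have d0: "expectation d = 0" unfolding d_def[abs_def] using one by simp
  \<comment> \<open>The weight \<open>s ^ k\<close> balances two geometric series of ratio
    \<open>1 / s\<close>: the weighted squares in mean, and the remainder \<open>1 / t\<close> of
    the inequality below at \<open>t = s ^ k\<close>.\<close>
  define s where "s = sqrt m"
  have s: "s > 1" "s * s = m" using m_gt1 by (auto simp: s_def)
  have "AE e in \<mu>. summable (\<lambda>k. s ^ k * (branch m ^^ k) d e ^ 2)"
  proof (rule AE_summable_of_summable_integrals)
    show "integrable \<mu> (\<lambda>e. s ^ k * (branch m ^^ k) d e ^ 2)" for k
      using branch_pow_centred_square(1)[OF _ d2 d0] by simp
    show "AE e in \<mu>. 0 \<le> s ^ k * (branch m ^^ k) d e ^ 2" for k using s by simp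
    have "expectation (\<lambda>e. s ^ k * (branch m ^^ k) d e ^ 2) = expectation (\<lambda>e. d e ^ 2) * (1 / s) ^ k" for k
      using s branch_pow_centred_square(2)[OF _ d2 d0, of k]
      by (simp add: power_divide power_mult_distrib flip: s(2))
    then show "summable (\<lambda>k. expectation (\<lambda>e. s ^ k * (branch m ^^ k) d e ^ 2))"
      using s by (simp add: summable_mult summable_geometric)
  qed
  then show ?thesis
  proof eventually_elim
    case (elim e)
    have amgm: "\<bar>y\<bar> \<le> t * y ^ 2 + 1 / t" if "t > 0" for y t :: real
    proof (cases "\<bar>y\<bar> \<le> 1 / t")
      case False
      then have "1 * \<bar>y\<bar> \<le> (t * \<bar>y\<bar>) * \<bar>y\<bar>"
        using that by (intro mult_right_mono) (auto simp: field_simps)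
      moreover have "(t * \<bar>y\<bar>) * \<bar>y\<bar> = t * y ^ 2" by (simp add: power2_eq_square)
      moreover have "1 / t \<ge> 0" using that by simp
      ultimately show ?thesis by linarith
    qed (use that in \<open>auto intro: add_increasing\<close>)
    have "summable (\<lambda>k. s ^ k * (branch m ^^ k) d e ^ 2 + (1 / s) ^ k)"
      using elim s by (intro summable_add summable_geometric) auto
    then have "summable (\<lambda>k. (branch m ^^ k) d e)"
      using amgm[of "s ^ _"] s
      by (intro summable_comparison_test'[of _ 0 "\<lambda>k. (branch m ^^ k) d e"]) (auto simp: power_divide)
    moreover have "(branch m ^^ k) d e = (branch m ^^ Suc k) (\<lambda>_. 1) e - (branch m ^^ k) (\<lambda>_. 1) e" for k
      unfolding d_def[abs_def] branch_pow_diff by (simp only: funpow_Suc_right o_def)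
    ultimately have "summable (\<lambda>k. (branch m ^^ Suc k) (\<lambda>_. 1) e - (branch m ^^ k) (\<lambda>_. 1) e)" by simp
    then have "convergent (\<lambda>n. \<Sum>k<n. (branch m ^^ Suc k) (\<lambda>_. 1) e - (branch m ^^ k) (\<lambda>_. 1) e)"
      by (simp only: summable_iff_convergent)
    then have "convergent (\<lambda>n. (branch m ^^ n) (\<lambda>_. 1) e - (branch m ^^ 0) (\<lambda>_. 1) e)"
      by (simp only: sum_lessThan_telescope[of "\<lambda>k. (branch m ^^ k) (\<lambda>_. 1) e"])
    then show ?case
      by (simp add: convergent_diff_const_right_iff)
  qed
qed

lemma AE_cond_over_mean_tendsto:
  "AE e in \<mu>. (\<lambda>n. cond m n e / mean_cond n) \<longlonglongrightarrow> lim (\<lambda>k. (branch m ^^ k) (\<lambda>_. 1) e)"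
proof -
  obtain B where B: "B > 0" "\<And>n. n \<ge> 1 \<Longrightarrow> expectation (\<lambda>e. cond m n e ^ 2) \<le> B * mean_cond n ^ 2"
    using cond_square_le by blast
  have sq: "integrable \<mu> (\<lambda>e. cond m n e ^ 2)" if "n \<ge> 1" for n
    using cond_Suc_square(1)[of "n - 1"] that by simp
  define D where "D = mean_res * B"
  have D: "D > 0" using mean_res_pos B by (simp add: D_def)
  have step: "mean_cond n - mean_cond (Suc n) \<le> D * mean_cond n ^ 2" if "n \<ge> 1" for n
  proof -
    have "mean_res * expectation (\<lambda>e. cond m n e ^ 2) \<le> mean_res * (B * mean_cond n ^ 2)"
      using B(2)[OF that] mean_res_pos by (intro mult_left_mono) auto
    then show ?thesis using mean_cond_diff_le[OF sq[OF that]] by (simp add: D_def mult.assoc)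
  qed
  have steps: "mean_cond n - mean_cond (n + k) \<le> real k * (D * mean_cond n ^ 2)" if "n \<ge> 1" for n k
  proof (induction k)
    case (Suc k)
    have "mean_cond (n + k) \<le> mean_cond n" using mean_cond_decseq by (simp add: decseq_def)
    then have "D * mean_cond (n + k) ^ 2 \<le> D * mean_cond n ^ 2"
      using D mean_cond_pos[of "n + k"] by (intro mult_left_mono power_mono) auto
    then show ?case using Suc step[of "n + k"] that by (simp add: algebra_simps)
  qed simp
  \<comment> \<open>The cube meets two demands. Over \<open>j\<close> generations the mean drops by
    at most \<open>j * D * \<delta> j ^ 2\<close>, which relative to \<open>\<delta> j\<close> is of
    order j^(-2) and summable; and the ratio of consecutive terms tends to 1, as filling the gaps
    requires and a geometric sequence would not allow.\<close>
  define \<delta> :: "nat \<Rightarrow> real" where "\<delta> j = 1 / real (Suc j) ^ 3" for j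
  have \<delta>_pos: "\<delta> j > 0" for j by (simp add: \<delta>_def)
  have \<delta>_dec: "decseq \<delta>"
    unfolding \<delta>_def by (rule decseq_SucI) (auto intro!: divide_left_mono power_mono)
  have inv: "(\<lambda>j. 1 / real (Suc j)) \<longlonglongrightarrow> 0"
    using LIMSEQ_inverse_real_of_nat by (simp add: inverse_eq_divide)
  have \<delta>_lim: "\<delta> \<longlonglongrightarrow> 0"
    using tendsto_power[OF inv, of 3] by (simp add: \<delta>_def[abs_def] power_divide)
  have \<delta>_ratio: "(\<lambda>j. \<delta> (Suc j) / \<delta> j) \<longlonglongrightarrow> 1"
  proof -
    have "(\<lambda>j. (1 - 1 / real (Suc (Suc j))) ^ 3) \<longlonglongrightarrow> (1 - 0) ^ 3"
      by (intro tendsto_intros LIMSEQ_Suc[OF inv])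
    moreover have "(1 - 1 / real (Suc (Suc j))) ^ 3 = \<delta> (Suc j) / \<delta> j" for j
    proof -
      have "1 - 1 / real (Suc (Suc j)) = real (Suc j) / real (Suc (Suc j))" by (simp add: field_simps)
      then show ?thesis by (simp only: \<delta>_def power_divide) simp
    qed
    ultimately show ?thesis by simp
  qed
  obtain N where N: "mono N" "\<And>j. N j \<ge> 1" "\<And>j. mean_cond (N j) \<le> \<delta> j"
      "(\<lambda>j. mean_cond (N j) / \<delta> j) \<longlonglongrightarrow> 1"
    using exists_dense_subsequence[OF mean_cond_decseq mean_cond_pos mean_cond_tendsto_0 _ step \<delta>_dec \<delta>_pos \<delta>_lim]
      D by (metis less_imp_le)
  have gap: "(mean_cond (N j) - mean_cond (N j + j)) / \<delta> j \<le> D * (1 / real (Suc j) ^ 2)" for j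
  proof -
    have "mean_cond (N j) ^ 2 \<le> \<delta> j ^ 2"
      using N(3)[of j] mean_cond_pos[of "N j"] by (intro power_mono) auto
    then have "mean_cond (N j) - mean_cond (N j + j) \<le> real j * (D * \<delta> j ^ 2)"
      using steps[OF N(2), of j j] D by (meson mult_left_mono of_nat_0_le_iff order_trans less_imp_le)
    then have "(mean_cond (N j) - mean_cond (N j + j)) / \<delta> j \<le> real j * (D * \<delta> j)"
      using \<delta>_pos[of j] by (simp add: pos_divide_le_eq power2_eq_square mult.assoc)
    also have "\<dots> \<le> real (Suc j) * (D * \<delta> j)"
      using D \<delta>_pos[of j] by (intro mult_right_mono) auto
    also have "\<dots> = D * (1 / real (Suc j) ^ 2)"
      by (simp add: \<delta>_def power3_eq_cube power2_eq_square del: of_nat_Suc)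
    finally show ?thesis .
  qed
  have gap_nonneg: "(mean_cond (N j) - mean_cond (N j + j)) / \<delta> j \<ge> 0" for j
    using mean_cond_decseq \<delta>_pos[of j] by (auto simp: decseq_def)
  have gap_summable: "summable (\<lambda>j. (mean_cond (N j) - mean_cond (N j + j)) / \<delta> j)"
  proof (rule summable_comparison_test')
    have "summable (\<lambda>j. inverse (real (Suc j) ^ 2))"
      using inverse_power_summable[of 2, where 'a = real] by (subst summable_Suc_iff) simp
    then show "summable (\<lambda>j. D * (1 / real (Suc j) ^ 2))"
      by (intro summable_mult) (simp add: inverse_eq_divide)
    show "norm ((mean_cond (N j) - mean_cond (N j + j)) / \<delta> j) \<le> D * (1 / real (Suc j) ^ 2)" for j
      using gap[of j] gap_nonneg[of j] by simp
  qed
  have aN: "(\<lambda>j. mean_cond (N j + j) / \<delta> j) \<longlonglongrightarrow> 1"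
  proof -
    have "(\<lambda>j. mean_cond (N j) / \<delta> j - (mean_cond (N j) - mean_cond (N j + j)) / \<delta> j) \<longlonglongrightarrow> 1 - 0"
      by (intro tendsto_diff N(4) summable_LIMSEQ_zero[OF gap_summable])
    then show ?thesis by (simp add: diff_divide_distrib)
  qed
  \<comment> \<open>By \<open>cond_add_le\<close> the differences are nonnegative on
    \<open>good\<close>, so a finite total mean suffices and no second moment is involved.\<close>
  have A1: "AE e in \<mu>. summable (\<lambda>j. ((branch m ^^ j) (cond m (N j)) e - cond m (N j + j) e) / \<delta> j)"
  proof (rule AE_summable_of_summable_integrals)
    fix j
    have int: "integrable \<mu> ((branch m ^^ j) (cond m (N j)))"
      "expectation ((branch m ^^ j) (cond m (N j))) = mean_cond (N j)"
      using branch_pow_moment[OF _ cond_integrable] by (simp_all add: mean_cond_def)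
    show "integrable \<mu> (\<lambda>e. ((branch m ^^ j) (cond m (N j)) e - cond m (N j + j) e) / \<delta> j)"
      using int(1) cond_integrable by auto
    show "AE e in \<mu>. 0 \<le> ((branch m ^^ j) (cond m (N j)) e - cond m (N j + j) e) / \<delta> j"
      using AE_good \<delta>_pos[of j] by (auto elim!: eventually_mono intro!: divide_nonneg_pos cond_add_le)
  next
    have eq: "expectation (\<lambda>e. ((branch m ^^ j) (cond m (N j)) e - cond m (N j + j) e) / \<delta> j) =
        (mean_cond (N j) - mean_cond (N j + j)) / \<delta> j" for j
    proof -
      have int: "integrable \<mu> ((branch m ^^ j) (cond m (N j)))"
        "expectation ((branch m ^^ j) (cond m (N j))) = mean_cond (N j)"
        using branch_pow_moment[OF _ cond_integrable] by (simp_all add: mean_cond_def)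
      then show ?thesis
        using Bochner_Integration.integral_diff[OF int(1) cond_integrable] by (simp add: mean_cond_def)
    qed
    show "summable (\<lambda>j. expectation (\<lambda>e. ((branch m ^^ j) (cond m (N j)) e - cond m (N j + j) e) / \<delta> j))"
      unfolding eq by (rule gap_summable)
  qed
  \<comment> \<open>Normalised and centred, with second moment at most \<open>B\<close> uniformly in
    \<open>j\<close> by \<open>cond_square_le\<close>. Applying \<open>branch\<close> as often as
    the index \<open>j\<close> therefore leaves at most \<open>B / m ^ j\<close>.\<close>
  define \<phi> where "\<phi> j e = cond m (N j) e / mean_cond (N j) - 1" for j e
  have [measurable]: "\<phi> j \<in> borel_measurable \<mu>" for j unfolding \<phi>_def[abs_def] by measurable
  have \<phi>_mean: "expectation (\<phi> j) = 0" for j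
    unfolding \<phi>_def[abs_def] using cond_integrable[of "N j"] mean_cond_pos[of "N j"]
    by (simp add: mean_cond_def)
  have \<phi>_alt: "\<phi> j e ^ 2 = cond m (N j) e ^ 2 / mean_cond (N j) ^ 2 - 2 * (cond m (N j) e / mean_cond (N j)) + 1" for j e
    by (simp add: \<phi>_def power2_diff power_divide)
  have \<phi>_sq: "integrable \<mu> (\<lambda>e. \<phi> j e ^ 2)" for j
    unfolding \<phi>_alt using sq[OF N(2)] cond_integrable by auto
  have \<phi>_le: "expectation (\<lambda>e. \<phi> j e ^ 2) \<le> B" for j
  proof -
    have "expectation (\<lambda>e. \<phi> j e ^ 2) = expectation (\<lambda>e. cond m (N j) e ^ 2) / mean_cond (N j) ^ 2 - 1"
      unfolding \<phi>_alt using sq[OF N(2)] cond_integrable mean_cond_pos[of "N j"]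
      by simp (simp add: mean_cond_def)
    also have "\<dots> \<le> B"
    proof -
      have "expectation (\<lambda>e. cond m (N j) e ^ 2) / mean_cond (N j) ^ 2 \<le> B"
        using B(2)[OF N(2)[of j]] mean_cond_pos[of "N j"] by (subst pos_divide_le_eq) auto
      then show ?thesis by simp
    qed
    finally show ?thesis .
  qed
  have A2: "AE e in \<mu>. summable (\<lambda>j. (branch m ^^ j) (\<phi> j) e ^ 2)"
  proof (rule AE_summable_of_summable_integrals)
    show "integrable \<mu> (\<lambda>e. (branch m ^^ j) (\<phi> j) e ^ 2)" for j
      by (rule branch_pow_centred_square(1)[OF _ \<phi>_sq \<phi>_mean]) simp
    show "summable (\<lambda>j. expectation (\<lambda>e. (branch m ^^ j) (\<phi> j) e ^ 2))"
    proof (rule summable_comparison_test')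
      show "summable (\<lambda>j. B * (1 / m) ^ j)"
        using m_gt1 by (intro summable_mult summable_geometric) auto
      fix j
      have "expectation (\<lambda>e. (branch m ^^ j) (\<phi> j) e ^ 2) = expectation (\<lambda>e. \<phi> j e ^ 2) / m ^ j"
        by (rule branch_pow_centred_square(2)[OF _ \<phi>_sq \<phi>_mean]) simp
      also have "\<dots> \<le> B / m ^ j" using \<phi>_le m_pos by (intro divide_right_mono) auto
      finally show "norm (expectation (\<lambda>e. (branch m ^^ j) (\<phi> j) e ^ 2)) \<le> B * (1 / m) ^ j"
        by (simp add: power_divide)
    qed
  qed simp
  show ?thesis using AE_good AE_martingale_convergent A1 A2
  proof eventually_elim
    case (elim e)
    define w where "w = lim (\<lambda>k. (branch m ^^ k) (\<lambda>_. 1) e)"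
    have w: "(\<lambda>k. (branch m ^^ k) (\<lambda>_. 1) e) \<longlonglongrightarrow> w"
      using elim(2) by (simp add: w_def convergent_LIMSEQ_iff)
    have "(\<lambda>j. \<bar>(branch m ^^ j) (\<phi> j) e\<bar>) \<longlonglongrightarrow> 0"
      using tendsto_real_sqrt[OF summable_LIMSEQ_zero[OF elim(4)]] by simp
    then have "(\<lambda>j. (branch m ^^ j) (\<phi> j) e) \<longlonglongrightarrow> 0" by (rule tendsto_rabs_zero_cancel)
    then have "(\<lambda>j. (branch m ^^ j) (cond m (N j)) e / mean_cond (N j) - (branch m ^^ j) (\<lambda>_. 1) e) \<longlonglongrightarrow> 0"
      unfolding \<phi>_def[abs_def] branch_pow_diff branch_pow_divide .
    from tendsto_add[OF this w]
    have "(\<lambda>j. (branch m ^^ j) (cond m (N j)) e / mean_cond (N j)) \<longlonglongrightarrow> w" by simp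
    \<comment> \<open>Since \<open>mean_cond (N j) / \<delta> j\<close> tends to 1, multiplying by
      it replaces the normalisation by \<open>\<delta> j\<close>; subtracting the summable error
      then replaces the iterate by the conductance at \<open>N j + j\<close>.\<close>
    from tendsto_diff[OF tendsto_mult[OF this N(4)] summable_LIMSEQ_zero[OF elim(3)]]
    have "(\<lambda>j. cond m (N j + j) e / \<delta> j) \<longlonglongrightarrow> w"
      using mean_cond_pos by (simp add: diff_divide_distrib less_imp_neq[THEN not_sym])
    then have "(\<lambda>n. cond m n e / mean_cond n) \<longlonglongrightarrow> w"
    proof (rule tendsto_along_dense_subsequence[where N = "\<lambda>j. N j + j" and \<delta> = \<delta>, rotated 7])
      show "mono (\<lambda>j. N j + j)" using N(1) by (auto simp: mono_def intro: add_mono)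
      show "cond m n e \<ge> 0" for n using good_pos(2)[OF elim(1)] by (rule less_imp_le)
    qed (use good_decseq[OF elim(1)] mean_cond_decseq mean_cond_pos \<delta>_pos aN \<delta>_ratio in auto)
    then show ?case by (simp add: w_def)
  qed
qed

end

section \<open>Transfer to an arbitrary probability space\<close>

theorem theorem1p1:
  fixes M :: "'a measure" and p :: "nat pmf"
    and N :: "nat list \<Rightarrow> 'a \<Rightarrow> nat" and \<xi> :: "nat list \<Rightarrow> 'a \<Rightarrow> real"
    and m :: real and C :: "nat \<Rightarrow> 'a \<Rightarrow> real" and W :: "'a \<Rightarrow> real"
  assumes M: "prob_space M"
    and p0: "pmf p 0 = 0"
    and nu2: "integrable (measure_pmf p) (\<lambda>k. real k ^ 2)"
    and m_def: "m = measure_pmf.expectation p real"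
    and m_gt1: "m > 1"
    and N_meas: "\<forall>x. N x \<in> measurable M (count_space UNIV)"
    and N_distr: "\<forall>x. distr M (count_space UNIV) (N x) = measure_pmf p"
    and xi_meas: "\<forall>x. \<xi> x \<in> borel_measurable M"
    and xi_distr: "\<forall>x. distr M borel (\<xi> x) = distr M borel (\<xi> [])"
    and xi_pos: "\<forall>x. AE \<omega> in M. \<xi> x \<omega> > 0"
    and xi_int: "integrable M (\<xi> [])"
    and xi_inv_int: "integrable M (\<lambda>\<omega>. 1 / \<xi> [] \<omega>)"
    and indep: "prob_space.indep_vars M (\<lambda>_. borel)
       (\<lambda>i \<omega>. case i of Inl x \<Rightarrow> real (N x \<omega>) | Inr x \<Rightarrow> \<xi> x \<omega>) UNIV"
    and C_def: "\<And>n \<omega>. C n \<omega> = eff_conductance (\<lambda>x. N x \<omega>) (\<lambda>x. m ^ length x * \<xi> x \<omega>) n"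
    and W_def: "\<And>\<omega>. W \<omega> = lim (\<lambda>n. real (card (level (\<lambda>x. N x \<omega>) n)) / m ^ n)"
  shows "AE \<omega> in M. (\<lambda>n. C n \<omega> / prob_space.expectation M (C n)) \<longlonglongrightarrow> W \<omega>"
proof -
  interpret M: prob_space M by (rule M)
  note N_meas' [measurable] = N_meas[rule_format] and xi_meas' [measurable] = xi_meas[rule_format]
  define \<eta> where "\<eta> = distr M borel (\<xi> [])"
  interpret galton_watson_env p \<eta> m
  proof (rule galton_watson_env.intro)
    show "prob_space \<eta>" unfolding \<eta>_def by (intro M.prob_space_distr) simp
    show "AE x in \<eta>. x > 0" unfolding \<eta>_def using xi_pos by (simp add: AE_distr_iff)
    show "integrable \<eta> (\<lambda>x. x)" "integrable \<eta> (\<lambda>x. 1 / x)"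
      unfolding \<eta>_def using xi_int xi_inv_int by (simp_all add: integrable_distr_eq)
  qed (use p0 nu2 m_def m_gt1 in \<open>auto simp: \<eta>_def\<close>)
  define Z :: "'a \<Rightarrow> env" where "Z \<omega> = (\<lambda>i. case i of Inl x \<Rightarrow> real (N x \<omega>) | Inr x \<Rightarrow> \<xi> x \<omega>)" for \<omega>
  have Z_coord: "(\<lambda>\<omega>. Z \<omega> i) \<in> borel_measurable M" for i
    unfolding Z_def by (cases i) auto
  have "Z \<in> M \<rightarrow>\<^sub>M PiM UNIV (\<lambda>_. borel)"
    using Z_coord by (intro measurable_PiM_single') auto
  then have Z [measurable]: "Z \<in> M \<rightarrow>\<^sub>M \<mu>"
    by (simp cong: measurable_cong_sets add: sets_mu)
  have law: "distr M borel (\<lambda>\<omega>. Z \<omega> i) = coord_law i" for i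
  proof (cases i)
    case (Inl x)
    have "distr M borel (\<lambda>\<omega>. real (N x \<omega>)) = distr (distr M (count_space UNIV) (N x)) borel real"
      by (subst distr_distr) (auto simp: o_def)
    then show ?thesis using N_distr by (simp add: Z_def Inl coord_law_def)
  next
    case (Inr x)
    have "distr M borel (\<xi> x) = \<eta>" unfolding \<eta>_def using xi_distr by blast
    then show ?thesis by (simp add: Z_def Inr coord_law_def)
  qed
  \<comment> \<open>Independence together with the marginals \<open>coord_law\<close> identifies the
    joint law as the product measure, so almost sure statements and expectations carry over along
    \<open>Z\<close>.\<close>
  have distr_Z: "distr M \<mu> Z = \<mu>"
  proof -
    have "M.indep_vars (\<lambda>_. borel) (\<lambda>i \<omega>. Z \<omega> i) UNIV"
      using indep by (simp add: Z_def)
    then have "distr M (PiM UNIV (\<lambda>_. borel)) (\<lambda>\<omega>. \<lambda>i\<in>UNIV. Z \<omega> i) = PiM UNIV (\<lambda>i. distr M borel (\<lambda>\<omega>. Z \<omega> i))"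
      using Z_coord by (subst (asm) M.indep_vars_iff_distr_eq_PiM') auto
    also have "\<dots> = \<mu>" by (simp add: law \<mu>_def)
    finally have "distr M (PiM UNIV (\<lambda>_. borel)) Z = \<mu>" by (simp add: restrict_def)
    moreover have "distr M \<mu> Z = distr M (PiM UNIV (\<lambda>_. borel)) Z"
      by (intro distr_cong) (auto simp: sets_mu)
    ultimately show ?thesis by simp
  qed
  have kids_Z: "kids (Z \<omega>) = (\<lambda>x. N x \<omega>)" for \<omega> by (simp add: kids_def Z_def fun_eq_iff)
  have AE_Z: "AE \<omega> in M. P (Z \<omega>)" if "AE e in \<mu>. P e" for P
    using that by (subst (asm) distr_Z[symmetric]) (rule AE_distrD[OF Z])
  have C_eq: "AE \<omega> in M. \<forall>n. C (Suc n) \<omega> = cond m n (Z \<omega>)"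
    using AE_Z[OF AE_good]
  proof eventually_elim
    case (elim \<omega>)
    from eff_conductance_eq_cond[where e = "Z \<omega>", OF m_pos good_pos(1)[OF elim]]
    show ?case unfolding C_def kids_Z by (simp add: Z_def)
  qed
  \<comment> \<open>The recursion describes \<open>C\<close> only almost surely, so replacing the
    integrand in the expectation calls for measurability of \<open>C n\<close> itself.\<close>
  have C_meas: "C n \<in> borel_measurable M" for n
  proof -
    have "(\<lambda>\<omega>. eff_conductance (\<lambda>x. N x \<omega>) (\<lambda>x. m ^ length x * \<xi> x \<omega>) n) \<in> borel_measurable M"
      by (rule measurable_eff_conductance) measurable
    also have "(\<lambda>\<omega>. eff_conductance (\<lambda>x. N x \<omega>) (\<lambda>x. m ^ length x * \<xi> x \<omega>) n) = C n"
      by (rule ext) (rule C_def[symmetric])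
    finally show ?thesis .
  qed
  have mean: "M.expectation (C (Suc n)) = mean_cond n" for n
  proof -
    have "M.expectation (C (Suc n)) = M.expectation (\<lambda>\<omega>. cond m n (Z \<omega>))"
      using C_eq by (intro integral_cong_AE C_meas) auto
    also have "\<dots> = integral\<^sup>L (distr M \<mu> Z) (cond m n)"
      by (rule integral_distr[symmetric]) auto
    finally show ?thesis by (simp add: distr_Z mean_cond_def)
  qed
  show ?thesis
    using C_eq AE_Z[OF AE_cond_over_mean_tendsto]
  proof eventually_elim
    case (elim \<omega>)
    have "W \<omega> = lim (\<lambda>k. (branch m ^^ k) (\<lambda>_. 1) (Z \<omega>))"
      unfolding W_def kids_Z[symmetric] card_level_eq_branch ..
    then have "(\<lambda>n. C (Suc n) \<omega> / M.expectation (C (Suc n))) \<longlonglongrightarrow> W \<omega>"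
      using elim by (simp add: mean)
    \<comment> \<open>The recursion starts at \<open>C 1\<close>; \<open>C 0\<close> is an infimum
      over the empty set, and undoing the shift does not affect the limit.\<close>
    then show ?case by (rule LIMSEQ_imp_Suc)
  qed
qed

end
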